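(* For every $k\geq8$ and $1\leq r\leq\infty$ there exist $\Phi\in\mathrm{SRT}^r_{k+1}(\mathbb{S}^1)$ and $\Psi\in\mathrm{SRT}^r_k(\mathbb{S}^1)$ such that: (i) $\mathcal{F}^{uu}(\Phi)$ is minimal but $\mathcal{F}^{ss}(\Phi)$ is not minimal; (ii) neither $\mathcal{F}^{uu}(\Psi)$ nor $\mathcal{F}^{ss}(\Psi)$ is minimal.
   Context: $\mathrm{IFS}^r_k(\mathbb{S}^1)$ is the set of families of $k$ orientation-preserving $C^r$ circle diffeomorphisms, identified up to reordering, with metric $\bar{\mathrm{d}}_r(\mathscr{F},\mathscr{G})=\min_{\sigma\in S_k}\sum_i\mathrm{d}_r(f_i,g_{\sigma(i)})$ ($\mathrm{d}_r$ the $C^r$ distance). $\Sigma_k=\{1,\dots,k\}^{\mathbb{Z}}$ with metric $\nu^m$, $m=\min\{i\geq0:\omega_i\ne\omega'_i\text{ or }\omega_{-i}\neq\omega'_{-i}\}$, $0<\nu<1$, shift $\tau$. $\mathrm{S}^r_k(\mathbb{S}^1)$ is the set of skew-products $\tau\ltimes\mathscr{F}(\omega,x)=(\tau\omega,f_{\omega_0}(x))$, $\mathscr{F}\in\mathrm{IFS}^r_k(\mathbb{S}^1)$, topologized via $\bar{\mathrm{d}}_r$ on the families; $\mathrm{SRT}^r_k(\mathbb{S}^1)$ is the set of those having a neighborhood of maps with a dense orbit. Strong leaves: $W^{ss}(\omega,x)=\bigcup_{n\geq0}\Phi^{-n}(W^s_{loc}(\tau^n\omega)\times\{f^n_\omega(x)\})$,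 $W^{uu}(\omega,x)=\bigcup_{n\geq0}\Phi^n(W^u_{loc}(\tau^{-n}\omega)\times\{f^{-n}_\omega(x)\})$, with $W^s_{loc}(\omega)$ (resp. $W^u_{loc}(\omega)$) the set of sequences agreeing with $\omega$ at indices $i\geq0$ (resp. $i<0$), and $\Phi^n(\omega,x)=(\tau^n\omega,f^n_\omega(x))$. $\mathcal{F}^{uu},\mathcal{F}^{ss}$ are the collections of these leaves; minimal means every leaf dense. *)

theory Defs
  imports "HOL-Analysis.Analysis" "HOL-Library.Extended_Nat" "HOL-Combinatorics.Permutations"
begin

section \<open>The circle S^1 = R/Z, represented by points of [0,1)\<close>

definition circ :: "real set" where
  "circ = {0..<1}"

definition cdist :: "real \<Rightarrow> real \<Rightarrow> real" where
  "cdist a b = min (frac (a - b)) (1 - frac (a - b))"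

definition Ck :: "enat \<Rightarrow> (real \<Rightarrow> real) \<Rightarrow> bool" where
  "Ck r F \<longleftrightarrow>
     (\<forall>j::nat. enat j < r \<longrightarrow> (\<forall>x. ((deriv ^^ j) F) differentiable (at x))) \<and>
     (\<forall>j::nat. enat j \<le> r \<longrightarrow> continuous_on UNIV ((deriv ^^ j) F))"

text \<open>An orientation-preserving C^r circle diffeomorphism, given by a lift F : R -> R
  (F(x+1) = F(x)+1, increasing, C^r with C^r inverse). The circle map is x |-> frac (F x).\<close>
definition circ_diff :: "enat \<Rightarrow> (real \<Rightarrow> real) \<Rightarrow> bool" where
  "circ_diff r F \<longleftrightarrow>
     (\<forall>x. F (x + 1) = F x + 1) \<and> strict_mono F \<and> Ck r F \<and>
     (\<exists>G. Ck r G \<and> (\<forall>x. G (F x) = x \<and> F (G x) = x))"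

text \<open>Componentwise distances: j = 0 is the C^0 distance on the circle, j \<ge> 1 is the
  sup distance of the j-th derivatives (independent of the choice of lifts).\<close>
definition dj :: "nat \<Rightarrow> (real \<Rightarrow> real) \<Rightarrow> (real \<Rightarrow> real) \<Rightarrow> real" where
  "dj j F G = (if j = 0 then (SUP x. cdist (F x) (G x))
               else (SUP x. \<bar>(deriv ^^ j) F x - (deriv ^^ j) G x\<bar>))"

definition dr :: "enat \<Rightarrow> (real \<Rightarrow> real) \<Rightarrow> (real \<Rightarrow> real) \<Rightarrow> real" where
  "dr r F G = (case r of
      enat n \<Rightarrow> Max ((\<lambda>j. dj j F G) ` {0..n})
    | \<infinity> \<Rightarrow> (\<Sum>j. (1/2)^j * min 1 (dj j F G)))"

definition IFS :: "enat \<Rightarrow> nat \<Rightarrow> (nat \<Rightarrow> real \<Rightarrow> real) \<Rightarrow> bool" where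
  "IFS r k Fs \<longleftrightarrow> (\<forall>i\<in>{1..k}. circ_diff r (Fs i))"

definition dbar :: "enat \<Rightarrow> nat \<Rightarrow> (nat \<Rightarrow> real \<Rightarrow> real) \<Rightarrow> (nat \<Rightarrow> real \<Rightarrow> real) \<Rightarrow> real" where
  "dbar r k Fs Gs = Min {(\<Sum>i\<in>{1..k}. dr r (Fs i) (Gs (\<sigma> i))) | \<sigma>. \<sigma> permutes {1..k}}"

definition Sigma_k :: "nat \<Rightarrow> (int \<Rightarrow> nat) set" where
  "Sigma_k k = {\<omega>. \<forall>i. \<omega> i \<in> {1..k}}"

definition shift :: "(int \<Rightarrow> nat) \<Rightarrow> (int \<Rightarrow> nat)" where
  "shift \<omega> = (\<lambda>i. \<omega> (i + 1))"

definition phase :: "nat \<Rightarrow> ((int \<Rightarrow> nat) \<times> real) set" where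
  "phase k = Sigma_k k \<times> circ"

definition skew :: "(nat \<Rightarrow> real \<Rightarrow> real) \<Rightarrow> (int \<Rightarrow> nat) \<times> real \<Rightarrow> (int \<Rightarrow> nat) \<times> real" where
  "skew Fs p = (shift (fst p), frac (Fs (fst p 0) (snd p)))"

definition seqdist :: "real \<Rightarrow> (int \<Rightarrow> nat) \<Rightarrow> (int \<Rightarrow> nat) \<Rightarrow> real" where
  "seqdist \<nu> \<omega> \<omega>' = (if \<omega> = \<omega>' then 0
      else \<nu> ^ (LEAST m::nat. \<omega> (int m) \<noteq> \<omega>' (int m) \<or> \<omega> (- int m) \<noteq> \<omega>' (- int m)))"

definition dense_in_phase :: "nat \<Rightarrow> real \<Rightarrow> ((int \<Rightarrow> nat) \<times> real) set \<Rightarrow> bool" where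
  "dense_in_phase k \<nu> A \<longleftrightarrow>
     (\<forall>p\<in>phase k. \<forall>\<epsilon>>0. \<exists>q\<in>A. seqdist \<nu> (fst p) (fst q) < \<epsilon> \<and> cdist (snd p) (snd q) < \<epsilon>)"

definition orbit :: "nat \<Rightarrow> (nat \<Rightarrow> real \<Rightarrow> real) \<Rightarrow> (int \<Rightarrow> nat) \<times> real \<Rightarrow> ((int \<Rightarrow> nat) \<times> real) set" where
  "orbit k Fs p = {q \<in> phase k. \<exists>n::nat. (skew Fs ^^ n) p = q \<or> (skew Fs ^^ n) q = p}"

definition has_dense_orbit :: "nat \<Rightarrow> real \<Rightarrow> (nat \<Rightarrow> real \<Rightarrow> real) \<Rightarrow> bool" where
  "has_dense_orbit k \<nu> Fs \<longleftrightarrow> (\<exists>p\<in>phase k. dense_in_phase k \<nu> (orbit k Fs p))"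

definition SRT :: "enat \<Rightarrow> nat \<Rightarrow> real \<Rightarrow> (nat \<Rightarrow> real \<Rightarrow> real) \<Rightarrow> bool" where
  "SRT r k \<nu> Fs \<longleftrightarrow> IFS r k Fs \<and>
     (\<exists>\<epsilon>>0. \<forall>Gs. IFS r k Gs \<and> dbar r k Fs Gs < \<epsilon> \<longrightarrow> has_dense_orbit k \<nu> Gs)"

text \<open>W^ss(omega,x) = U_n Phi^{-n}(W^s_loc(tau^n omega) x {f^n_omega(x)}), with Phi^{-n}(S) the
  preimage of S under Phi^n; note Phi^n(omega,x) = (tau^n omega, f^n_omega x).\<close>
definition Wss :: "nat \<Rightarrow> (nat \<Rightarrow> real \<Rightarrow> real) \<Rightarrow> (int \<Rightarrow> nat) \<times> real \<Rightarrow> ((int \<Rightarrow> nat) \<times> real) set" where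
  "Wss k Fs p = {q \<in> phase k. \<exists>n::nat.
      (\<forall>i\<ge>0. fst ((skew Fs ^^ n) q) i = fst ((skew Fs ^^ n) p) i) \<and>
      snd ((skew Fs ^^ n) q) = snd ((skew Fs ^^ n) p)}"

text \<open>W^uu(omega,x) = U_n Phi^n(W^u_loc(tau^{-n} omega) x {f^{-n}_omega(x)}), where
  f^{-n}_omega(x) is the unique y in S^1 with Phi^n(tau^{-n} omega, y) = (omega, x).\<close>
definition Wuu :: "nat \<Rightarrow> (nat \<Rightarrow> real \<Rightarrow> real) \<Rightarrow> (int \<Rightarrow> nat) \<times> real \<Rightarrow> ((int \<Rightarrow> nat) \<times> real) set" where
  "Wuu k Fs p = {(skew Fs ^^ n) (\<eta>, y) | n \<eta> y.
      \<eta> \<in> Sigma_k k \<and> (\<forall>i<0. \<eta> i = fst p (i - int n)) \<and> y \<in> circ \<and>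
      snd ((skew Fs ^^ n) (\<lambda>i. fst p (i - int n), y)) = snd p}"

definition uu_minimal :: "nat \<Rightarrow> real \<Rightarrow> (nat \<Rightarrow> real \<Rightarrow> real) \<Rightarrow> bool" where
  "uu_minimal k \<nu> Fs \<longleftrightarrow> (\<forall>p\<in>phase k. dense_in_phase k \<nu> (Wuu k Fs p))"

definition ss_minimal :: "nat \<Rightarrow> real \<Rightarrow> (nat \<Rightarrow> real \<Rightarrow> real) \<Rightarrow> bool" where
  "ss_minimal k \<nu> Fs \<longleftrightarrow> (\<forall>p\<in>phase k. dense_in_phase k \<nu> (Wss k Fs p))"

end

theory Submission
  imports Defs
begin

text \<open>On the circle coordinate, the strong unstable (stable) leaf of \<open>(\<omega>, x)\<close> consists of the points
  \<open>f\<^sub>w (f\<^sub>\<omega>\<^sup>-\<^sup>n x)\<close> (resp. \<open>f\<^sub>w\<^sup>-\<^sup>1 (f\<^sub>\<omega>\<^sup>n x)\<close>) over all words \<open>w\<close> of length \<open>n\<close>.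

  Robust transitivity comes from a blender: two maps contract an arc \<open>L\<close> with rate about 2/3 and the
  images of a smaller arc \<open>J\<close> cover \<open>J\<close>, so every forward orbit starting in \<open>L\<close> is dense in \<open>J\<close>. It remains to see
  that every open arc meets \<open>L\<close> after some forward word and \<open>J\<close> after some backward word; where this
  is not immediate, some map (or inverse) expands the arc by a factor 2 until it is long enough. All these conditions
  are open in the \<open>C\<^sup>1\<close> topology.

  For \<open>\<Psi>\<close> such a family is chosen with a common fixed point, whose leaves lie over that point.
  For \<open>\<Phi>\<close>, consider the three Cantor sets \<open>C + j/3\<close>, where \<open>C = C/4 \<union> (C + 1/3)/4\<close>.
  The inverses of all maps are affine near these sets and preserve their union, so some stable leaf lies over it; but
  two of the maps together push every point of the circle into a gap of \<open>\<Union>\<^sub>j (C + j/3)\<close> containing the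
  blender, which gives forward minimality.\<close>

section \<open>Smooth functions of one real variable\<close>

text \<open>Derivatives enter as existential witnesses rather than through \<open>deriv\<close>, so
  that each closure property becomes an induction on the order in which the derivative is
  generalised.\<close>

fun ndiff :: "nat \<Rightarrow> (real \<Rightarrow> real) \<Rightarrow> bool" where
  "ndiff 0 f = True"
| "ndiff (Suc n) f = (\<exists>f'. (\<forall>x. (f has_real_derivative f' x) (at x)) \<and> ndiff n f')"

definition smooth :: "(real \<Rightarrow> real) \<Rightarrow> bool" where
  "smooth f \<longleftrightarrow> (\<forall>n. ndiff n f)"

declare ndiff.simps(2) [simp del]

lemma ndiff_SucI:
  assumes "\<And>x. (f has_real_derivative f' x) (at x)" "ndiff n f'"
  shows "ndiff (Suc n) f"
  using assms unfolding ndiff.simps by blast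

lemma ndiff_SucD:
  "ndiff (Suc n) f \<Longrightarrow> \<exists>f'. (\<forall>x. (f has_real_derivative f' x) (at x)) \<and> ndiff n f'"
  unfolding ndiff.simps by blast

lemma ndiff_mono: "ndiff (Suc n) f \<Longrightarrow> ndiff n f"
proof (induction n arbitrary: f)
  case (Suc n)
  obtain f' where f': "\<And>x. (f has_real_derivative f' x) (at x)" "ndiff (Suc n) f'"
    using ndiff_SucD[OF Suc.prems] by blast
  show ?case by (rule ndiff_SucI[OF f'(1) Suc.IH[OF f'(2)]])
qed simp

lemma ndiff_const: "ndiff n (\<lambda>x. c)"
proof (induction n arbitrary: c)
  case (Suc n)
  have "((\<lambda>x. c) has_real_derivative 0) (at x)" for x by simp
  then show ?case using Suc.IH[of 0] by (intro ndiff_SucI[where f'="\<lambda>x. 0"]) auto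
qed simp

lemma ndiff_ident: "ndiff n (\<lambda>x. x)"
proof (cases n)
  case (Suc m)
  show ?thesis unfolding Suc
    by (rule ndiff_SucI[where f'="\<lambda>x. 1"]) (auto intro: ndiff_const)
qed simp

lemma ndiff_add: "ndiff n f \<Longrightarrow> ndiff n g \<Longrightarrow> ndiff n (\<lambda>x. f x + g x)"
proof (induction n arbitrary: f g)
  case (Suc n)
  obtain f' where f': "\<And>x. (f has_real_derivative f' x) (at x)" "ndiff n f'"
    using ndiff_SucD[OF Suc.prems(1)] by blast
  obtain g' where g': "\<And>x. (g has_real_derivative g' x) (at x)" "ndiff n g'"
    using ndiff_SucD[OF Suc.prems(2)] by blast
  show ?case
    by (rule ndiff_SucI[OF DERIV_add[OF f'(1) g'(1)] Suc.IH[OF f'(2) g'(2)]])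
qed simp

lemma ndiff_mult: "ndiff n f \<Longrightarrow> ndiff n g \<Longrightarrow> ndiff n (\<lambda>x. f x * g x)"
proof (induction n arbitrary: f g)
  case (Suc n)
  obtain f' where f': "\<And>x. (f has_real_derivative f' x) (at x)" "ndiff n f'"
    using ndiff_SucD[OF Suc.prems(1)] by blast
  obtain g' where g': "\<And>x. (g has_real_derivative g' x) (at x)" "ndiff n g'"
    using ndiff_SucD[OF Suc.prems(2)] by blast
  show ?case
    by (rule ndiff_SucI[OF DERIV_mult[OF f'(1) g'(1)]])
      (intro ndiff_add Suc.IH f' g' ndiff_mono[OF Suc.prems(1)] ndiff_mono[OF Suc.prems(2)])
qed simp

lemma ndiff_compose: "ndiff n f \<Longrightarrow> ndiff n g \<Longrightarrow> ndiff n (\<lambda>x. f (g x))"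
proof (induction n arbitrary: f g)
  case (Suc n)
  obtain f' where f': "\<And>x. (f has_real_derivative f' x) (at x)" "ndiff n f'"
    using ndiff_SucD[OF Suc.prems(1)] by blast
  obtain g' where g': "\<And>x. (g has_real_derivative g' x) (at x)" "ndiff n g'"
    using ndiff_SucD[OF Suc.prems(2)] by blast
  show ?case
    by (rule ndiff_SucI[OF DERIV_chain2[OF f'(1) g'(1)]])
      (rule ndiff_mult[OF Suc.IH[OF f'(2) ndiff_mono[OF Suc.prems(2)]] g'(2)])
qed simp

text \<open>The derivative of 1/f is written as a product of f' with two factors 1/f, so the
  previous order of 1/f itself feeds the induction step.\<close>

lemma ndiff_inverse: "ndiff n f \<Longrightarrow> (\<And>x. f x \<noteq> 0) \<Longrightarrow> ndiff n (\<lambda>x. inverse (f x))"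
proof (induction n arbitrary: f)
  case (Suc n)
  obtain f' where f': "\<And>x. (f has_real_derivative f' x) (at x)" "ndiff n f'"
    using ndiff_SucD[OF Suc.prems(1)] by blast
  have IH: "ndiff n (\<lambda>x. inverse (f x))"
    by (rule Suc.IH[OF ndiff_mono[OF Suc.prems(1)] Suc.prems(2)])
  have "((\<lambda>x. inverse (f x)) has_real_derivative
      (- 1) * (inverse (f x) * f' x * inverse (f x))) (at x)" for x
    using DERIV_inverse'[OF f'(1) Suc.prems(2)] by simp
  then show ?case
    by (rule ndiff_SucI) (intro ndiff_mult ndiff_const IH f')
qed simp

lemma smooth_const: "smooth (\<lambda>x. c)" and smooth_ident: "smooth (\<lambda>x. x)"
  by (auto simp: smooth_def ndiff_const ndiff_ident)

lemma smooth_add: "smooth f \<Longrightarrow> smooth g \<Longrightarrow> smooth (\<lambda>x. f x + g x)"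
  and smooth_mult: "smooth f \<Longrightarrow> smooth g \<Longrightarrow> smooth (\<lambda>x. f x * g x)"
  and smooth_compose: "smooth f \<Longrightarrow> smooth g \<Longrightarrow> smooth (\<lambda>x. f (g x))"
  by (auto simp: smooth_def ndiff_add ndiff_mult ndiff_compose)

lemma smooth_diff: "smooth f \<Longrightarrow> smooth g \<Longrightarrow> smooth (\<lambda>x. f x - g x)"
  using smooth_add[OF _ smooth_mult[OF smooth_const[of "-1"]], of f g] by simp

lemma smooth_divide:
  assumes "smooth f" "smooth g" "\<And>x. g x \<noteq> 0"
  shows "smooth (\<lambda>x. f x / g x)"
  using assms by (auto simp: smooth_def divide_inverse ndiff_mult ndiff_inverse)

lemma smooth_antiderivative:
  assumes "\<And>x. (F has_real_derivative f x) (at x)" "smooth f"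
  shows "smooth F"
  unfolding smooth_def
proof
  show "ndiff n F" for n
    using assms by (cases n) (auto simp: smooth_def intro: ndiff_SucI)
qed

text \<open>Bootstrapping: G' = 1 / F'(G), so n-fold differentiability of G gives the next order,
  and positivity of F' keeps the quotient defined.\<close>

lemma smooth_inverse_function:
  assumes F: "smooth F" and F': "\<And>x. (F has_real_derivative F' x) (at x)" "\<And>x. F' x > 0"
    and G: "\<And>x. G (F x) = x" "\<And>x. F (G x) = x"
  shows "smooth G"
proof -
  have "isCont F x" for x using F' DERIV_isCont by blast
  have cG: "isCont G x" for x
    using isCont_inverse_function[of 1 "G x" G F] G \<open>\<And>x. isCont F x\<close> by auto
  have dG: "(G has_real_derivative inverse (F' (G x))) (at x)" for x
    using DERIV_inverse_function[where f=F and g=G and x=x and a="x-1" and b="x+1" and D="F' (G x)"]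
      F' cG G by (auto simp: less_imp_neq[OF F'(2), symmetric])
  have F'n: "ndiff n F'" for n
  proof -
    have "ndiff (Suc n) F" using F by (auto simp: smooth_def)
    then obtain f' where f': "\<And>x. (F has_real_derivative f' x) (at x)" "ndiff n f'"
      using ndiff_SucD by blast
    have "f' = F'" using DERIV_unique[OF f'(1) F'(1)] by blast
    with f' show ?thesis by simp
  qed
  have "ndiff n G" for n
  proof (induction n)
    case (Suc n)
    have "F' (G x) \<noteq> 0" for x using F'(2)[of "G x"] by linarith
    then show ?case
      by (intro ndiff_SucI[OF dG] ndiff_inverse ndiff_compose[OF F'n Suc]) 
  qed simp
  then show ?thesis by (simp add: smooth_def)
qed

lemma ndiff_funpow_deriv:
  "ndiff (Suc j + m) f \<Longrightarrow> (deriv ^^ j) f differentiable (at x)"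
proof (induction j arbitrary: f)
  case 0
  then have "ndiff (Suc m) f" by simp
  from ndiff_SucD[OF this] show ?case by (auto simp: real_differentiable_def)
next
  case (Suc j)
  then have "ndiff (Suc (Suc j + m)) f" by simp
  then obtain f' where f': "\<And>x. (f has_real_derivative f' x) (at x)" "ndiff (Suc j + m) f'"
    using ndiff_SucD by blast
  then have "deriv f = f'" using DERIV_imp_deriv by blast
  then have "(deriv ^^ Suc j) f = (deriv ^^ j) f'" unfolding funpow_Suc_right by simp
  then show ?case using Suc.IH[OF f'(2)] by simp
qed

lemma smooth_Ck:
  assumes "smooth f" shows "Ck r f"
proof -
  have d: "(deriv ^^ j) f differentiable (at x)" for j x
    using ndiff_funpow_deriv[of j 0] assms by (auto simp: smooth_def)
  then have "continuous_on UNIV ((deriv ^^ j) f)" for j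
    by (meson continuous_at_imp_continuous_on differentiable_imp_continuous_within)
  with d show ?thesis by (simp add: Ck_def)
qed

section \<open>A smooth step and a smooth ramp\<close>

text \<open>The powers of 1/x make the family closed under differentiation up to linear
  combinations; \<open>flat 0\<close> is the classical exp(-1/x), flat to infinite order at
  0.\<close>

definition flat :: "nat \<Rightarrow> real \<Rightarrow> real" where
  "flat n x = (if x > 0 then inverse x ^ n * exp (- inverse x) else 0)"

lemma flat_tendsto_0: "(flat n \<longlongrightarrow> 0) (at 0)"
proof -
  have "((\<lambda>x. inverse x ^ n * exp (- inverse x)) \<longlongrightarrow> (0::real)) (at_right 0)"
    using filterlim_compose[OF tendsto_power_div_exp_0[of n] filterlim_inverse_at_top_right]
    by (simp add: exp_minus divide_inverse)
  then have "(flat n \<longlongrightarrow> 0) (at_right 0)"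
    by (rule Lim_transform_eventually)
      (auto simp: flat_def eventually_at_right_field intro: exI[of _ 1])
  moreover have "(flat n \<longlongrightarrow> 0) (at_left 0)"
    by (rule Lim_transform_eventually[OF tendsto_const])
      (auto simp: flat_def eventually_at_left_field intro: exI[of _ "-1"])
  ultimately show ?thesis by (simp add: filterlim_at_split)
qed

lemma flat_deriv:
  "(flat n has_real_derivative flat (n + 2) x - real n * flat (n + 1) x) (at x)"
proof (cases x "0::real" rule: linorder_cases)
  case less
  have "((\<lambda>x. 0) has_real_derivative 0) (at x)" by simp
  then have "(flat n has_real_derivative 0) (at x)"
    by (rule has_field_derivative_transform_within_open[of _ _ _ "{..<0}"]) (use less in \<open>auto simp: flat_def\<close>)
  then show ?thesis using less by (simp add: flat_def)
next
  case equal
  \<comment> \<open>Dividing by h only raises the exponent, so the difference quotient at 0 is the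
    next member of the family.\<close>
  have "((\<lambda>h. flat (Suc n) h) \<longlongrightarrow> 0) (at 0)" by (rule flat_tendsto_0)
  moreover have "(flat n (0 + h) - flat n 0) / h = flat (Suc n) h" for h
    by (simp add: flat_def field_simps)
  ultimately have "(flat n has_real_derivative 0) (at 0)"
    unfolding DERIV_def by simp
  then show ?thesis using equal by (simp add: flat_def)
next
  case greater
  \<comment> \<open>For n = 0 the truncated exponent n - 1 is compensated by the factor n.\<close>
  have *: "real n * (inverse x ^ (n - 1) * inverse x) = real n * inverse x ^ n"
    by (cases n) auto
  have "((\<lambda>x. inverse x ^ n * exp (- inverse x)) has_real_derivative
     exp (- inverse x) * inverse x * (inverse x * inverse x ^ n - real n * (inverse x ^ (n - 1) * inverse x))) (at x)"
    using greater by (auto intro!: derivative_eq_intros simp: algebra_simps power2_eq_square)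
  then have "((\<lambda>x. inverse x ^ n * exp (- inverse x)) has_real_derivative
     flat (n + 2) x - real n * flat (n + 1) x) (at x)"
    using greater unfolding * by (simp add: flat_def algebra_simps)
  then show ?thesis
    by (rule has_field_derivative_transform_within_open[of _ _ _ "{0<..}"]) (use greater in \<open>auto simp: flat_def\<close>)
qed

lemma smooth_flat: "smooth (flat n)"
proof -
  have "ndiff m (flat n)" for m
  proof (induction m arbitrary: n)
    case (Suc m)
    have "ndiff m (\<lambda>x. flat (n + 2) x + (- real n) * flat (n + 1) x)"
      by (intro ndiff_add ndiff_mult ndiff_const Suc.IH)
    then show ?case
      by (intro ndiff_SucI[of _ "\<lambda>x. flat (n + 2) x + (- real n) * flat (n + 1) x"])
        (use flat_deriv[of n] in simp_all)
  qed simp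
  then show ?thesis by (simp add: smooth_def)
qed

text \<open>The quotient form makes the graph symmetric about (0, 1/2). This symmetry lets an
  antiderivative join the identity with no offset.\<close>

definition step :: "real \<Rightarrow> real" where
  "step x = flat 0 (1 + x) / (flat 0 (1 + x) + flat 0 (1 - x))"

lemma flat_nonneg: "flat n x \<ge> 0" by (simp add: flat_def)

lemma flat_0_sum_pos: "flat 0 (1 + x) + flat 0 (1 - x) > 0"
  by (auto simp: flat_def add_pos_pos)

lemma smooth_step: "smooth step"
  unfolding step_def
  by (intro smooth_divide smooth_add smooth_diff smooth_const smooth_ident
      smooth_compose[OF smooth_flat]) (use flat_0_sum_pos in \<open>simp add: less_imp_neq[symmetric]\<close>)

lemma step_bounds: "0 \<le> step x" "step x \<le> 1"
  using flat_0_sum_pos[of x] flat_nonneg[of 0] by (auto simp: step_def divide_simps)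

lemma step_left: "x \<le> -1 \<Longrightarrow> step x = 0" and step_right: "x \<ge> 1 \<Longrightarrow> step x = 1"
  by (auto simp: step_def flat_def)

lemma step_minus: "step (- x) = 1 - step x"
  using flat_0_sum_pos[of x] by (simp add: step_def field_simps)

text \<open>By the symmetry of \<open>step\<close>, R x - R (-x) has derivative 1 and vanishes at 0,
  hence equals x; and R (-x) = 0 once x >= 1.\<close>

lemma ramp_exists:
  "\<exists>R. (\<forall>x. (R has_real_derivative step x) (at x)) \<and> (\<forall>x\<le>-1. R x = 0) \<and> (\<forall>x\<ge>1. R x = x)"
proof -
  obtain s' where "\<forall>x. (step has_real_derivative s' x) (at x)"
    using smooth_step unfolding smooth_def by (metis ndiff_SucD)
  then have "isCont step x" for x using DERIV_isCont by blast
  then obtain F where F: "\<And>x. (F has_real_derivative step x) (at x)"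
    using einterval_antiderivative[of "-\<infinity>" "\<infinity>" step]
    by (auto simp: has_real_derivative_iff_has_vector_derivative)
  define R where "R = (\<lambda>x. F x - F (-1))"
  have R: "(R has_real_derivative step x) (at x)" for x
    unfolding R_def using F by (auto intro!: derivative_eq_intros)
  have left: "R x = 0" if "x \<le> -1" for x
  proof (cases "x = -1")
    case False
    with that have "\<exists>z. x < z \<and> z < -1 \<and> R (-1) - R x = (-1 - x) * step z"
      by (intro MVT2) (auto intro: R)
    then show ?thesis by (auto simp: step_left R_def)
  qed (simp add: R_def)
  have odd: "R x - R (- x) = x" for x
  proof -
    have "((\<lambda>x. R (- x)) has_real_derivative step (- x) * (- 1)) (at x)" for x
      by (rule DERIV_chain2[OF R]) (auto intro!: derivative_eq_intros)
    then have "((\<lambda>x. R x - R (- x) - x) has_real_derivative step x - step (- x) * (- 1) - 1) (at x)" for x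
      by (intro DERIV_diff R DERIV_ident)
    then have "((\<lambda>x. R x - R (- x) - x) has_real_derivative 0) (at x)" for x
      by (simp add: step_minus)
    then have "(\<lambda>x. R x - R (- x) - x) x = (\<lambda>x. R x - R (- x) - x) 0"
      using DERIV_isconst_all by blast
    then show ?thesis by simp
  qed
  have "R x = x" if "x \<ge> 1" for x using odd[of x] left[of "-x"] that by simp
  with R left show ?thesis by blast
qed

definition ramp1 :: "real \<Rightarrow> real" where
  "ramp1 = (SOME R. (\<forall>x. (R has_real_derivative step x) (at x)) \<and> (\<forall>x\<le>-1. R x = 0) \<and> (\<forall>x\<ge>1. R x = x))"

lemma ramp1: "(ramp1 has_real_derivative step x) (at x)" "x \<le> -1 \<Longrightarrow> ramp1 x = 0" "x \<ge> 1 \<Longrightarrow> ramp1 x = x"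
  using someI_ex[OF ramp_exists] unfolding ramp1_def by blast+

text \<open>Rescaling keeps the slopes and shrinks the rounded corner to radius 1/2000, so the model
  maps below are exactly affine outside tiny intervals.\<close>

definition ramp :: "real \<Rightarrow> real" where "ramp x = ramp1 (2000 * x) / 2000"

definition dramp :: "real \<Rightarrow> real" where "dramp x = step (2000 * x)"

lemma ramp_deriv: "(ramp has_real_derivative dramp x) (at x)"
  unfolding ramp_def dramp_def
  using DERIV_cdivide[OF DERIV_chain2[OF ramp1(1) DERIV_cmult_Id[of 2000]], of 2000] by simp

lemma smooth_ramp: "smooth ramp"
proof (rule smooth_antiderivative[OF ramp_deriv])
  show "smooth dramp"
    unfolding dramp_def by (intro smooth_compose[OF smooth_step] smooth_mult smooth_const smooth_ident)
qed

lemma ramp_left: "x \<le> -1/2000 \<Longrightarrow> ramp x = 0" and ramp_right: "x \<ge> 1/2000 \<Longrightarrow> ramp x = x"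
  by (auto simp: ramp_def ramp1)

lemma dramp_bounds: "0 \<le> dramp x" "dramp x \<le> 1"
  by (auto simp: dramp_def step_bounds)

lemma dramp_left: "x \<le> -1/2000 \<Longrightarrow> dramp x = 0" and dramp_right: "x \<ge> 1/2000 \<Longrightarrow> dramp x = 1"
  by (auto simp: dramp_def step_left step_right)

section \<open>Lifts of circle diffeomorphisms\<close>

lemma translate_int:
  fixes F :: "real \<Rightarrow> real"
  assumes "\<And>x. F (x + 1) = F x + 1"
  shows "F (x + of_int n) = F x + of_int n"
proof -
  have nat: "F (x + of_nat m) = F x + of_nat m" for x m
  proof (induction m)
    case (Suc m)
    then show ?case using assms[of "x + of_nat m"] by (simp add: algebra_simps)
  qed simp
  show ?thesis
  proof (cases n rule: int_cases2)
    case (nonneg m)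
    then show ?thesis using nat by simp
  next
    case (nonpos m)
    then show ?thesis using nat[of "x - of_nat m" m] by simp
  qed
qed

definition lift_diffeo :: "(real \<Rightarrow> real) \<Rightarrow> bool" where
  "lift_diffeo F \<longleftrightarrow> (\<forall>x. F (x + 1) = F x + 1) \<and> smooth F \<and>
     (\<exists>F'. \<forall>x. (F has_real_derivative F' x) (at x) \<and> F' x > 0)"

lemma translates_surj:
  fixes F :: "real \<Rightarrow> real"
  assumes "\<And>x. F (x + 1) = F x + 1" "continuous_on UNIV F"
  shows "\<exists>x. F x = y"
proof -
  obtain n :: int where n: "F 0 - y < of_int n" using ex_less_of_int by blast
  obtain m :: int where m: "y - F 0 < of_int m" using ex_less_of_int by blast
  have "F (0 + of_int (- n)) = F 0 + of_int (- n)" "F (0 + of_int m) = F 0 + of_int m"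
    by (rule translate_int[of F, OF assms(1)])+
  then have "F (of_int (- n)) \<le> y" "y \<le> F (of_int m)" using n m by auto
  moreover have "of_int (- n) \<le> (of_int m :: real)" using n m by simp
  ultimately show ?thesis
    using IVT'[of F "of_int (- n)" y "of_int m"] continuous_on_subset[OF assms(2)] by blast
qed

text \<open>A smooth lift with positive derivative has a smooth inverse, so one construction serves
  every r, infinity included.\<close>

lemma lift_diffeo_circ_diff:
  assumes "lift_diffeo F" shows "circ_diff r F"
proof -
  from assms obtain F' where F': "\<And>x. (F has_real_derivative F' x) (at x)" "\<And>x. F' x > 0"
    and per: "\<And>x. F (x + 1) = F x + 1" and sm: "smooth F"
    by (auto simp: lift_diffeo_def)
  have mono: "strict_mono F"
    unfolding strict_mono_def using F' by (meson DERIV_pos_imp_increasing)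
  have "continuous_on UNIV F"
    using F' by (meson DERIV_isCont continuous_at_imp_continuous_on)
  then have "surj F" using translates_surj per by (metis surjI)
  define G where "G = inv F"
  have G: "G (F x) = x" "F (G x) = x" for x
    using \<open>surj F\<close> strict_mono_imp_inj_on[OF mono] by (auto simp: G_def surj_f_inv_f)
  have "smooth G" by (rule smooth_inverse_function[OF sm F' G])
  then show ?thesis
    using per mono G sm smooth_Ck unfolding circ_diff_def by blast
qed

lemma lift_diffeo_translation: "lift_diffeo (\<lambda>x. x + c)"
  unfolding lift_diffeo_def
  by (auto intro!: smooth_add smooth_ident smooth_const exI[of _ "\<lambda>x. 1"] derivative_eq_intros)

text \<open>With s = -1 the map is reflected on both sides, with s = 1 it is composed with
  rotations; the mirrored and rotated model maps arise this way.\<close>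

lemma lift_diffeo_affine_conj:
  assumes "lift_diffeo F" "s = 1 \<or> s = -1"
  shows "lift_diffeo (\<lambda>x. s * F (s * x + a) + b)"
proof -
  from assms obtain F' where F': "\<And>x. (F has_real_derivative F' x) (at x)" "\<And>x. F' x > 0"
    and per: "\<And>x. F (x + 1) = F x + 1" and sm: "smooth F"
    by (auto simp: lift_diffeo_def)
  have "((\<lambda>x. F (s * x + a)) has_real_derivative F' (s * x + a) * s) (at x)" for x
    by (rule DERIV_chain2[OF F'(1)]) (auto intro!: derivative_eq_intros)
  then have "((\<lambda>x. s * F (s * x + a) + b) has_real_derivative s * (F' (s * x + a) * s) + 0) (at x)" for x
    by (intro DERIV_add DERIV_cmult DERIV_const)
  moreover have "s * (F' (s * x + a) * s) + 0 = F' (s * x + a)" for x using assms(2) by auto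
  ultimately have "((\<lambda>x. s * F (s * x + a) + b) has_real_derivative F' (s * x + a)) (at x)" for x
    by metis
  moreover have "s * F (s * (x + 1) + a) + b = s * F (s * x + a) + b + 1" for x
    using assms(2) per[of "x + a"] per[of "- x - 1 + a"] by (auto simp: algebra_simps)
  moreover have "smooth (\<lambda>x. s * F (s * x + a) + b)"
    by (intro smooth_add smooth_mult smooth_const smooth_compose[OF sm] smooth_ident)
  ultimately show ?thesis
    unfolding lift_diffeo_def using F'(2) by (intro conjI exI[of _ "\<lambda>x. F' (s * x + a)"] allI) auto
qed

section \<open>Gluing a map given near [0, 1] into a lift\<close>

text \<open>Since p obeys the translation rule near 0, the glued function coincides with one
  translate of p on a neighbourhood of [n, n + 1]; hence there is no seam at the integers.\<close>

lemma floor_frac_local: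
  fixes p :: "real \<Rightarrow> real"
  assumes "\<And>x. \<bar>x\<bar> < \<eta> \<Longrightarrow> p (x + 1) = p x + c" "\<eta> \<le> 1"
    and "- \<eta> < y - of_int n" "y - of_int n < 1 + \<eta>"
  shows "p (frac y) + c * of_int \<lfloor>y\<rfloor> = p (y - of_int n) + c * of_int n"
proof -
  consider "y - of_int n < 0" | "0 \<le> y - of_int n" "y - of_int n < 1" | "1 \<le> y - of_int n" by linarith
  then show ?thesis
  proof cases
    case 1
    then have "of_int \<lfloor>y\<rfloor> = (of_int n - 1 :: real)" using assms by (subst floor_unique[of "n - 1"]) auto
    then show ?thesis using assms(1)[of "y - of_int n"] 1 assms(2,3) by (simp add: frac_def) (simp add: algebra_simps)
  next
    case 2
    then have "\<lfloor>y\<rfloor> = n" by (intro floor_unique) auto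
    then show ?thesis by (simp add: frac_def)
  next
    case 3
    then have "of_int \<lfloor>y\<rfloor> = (of_int n + 1 :: real)" using assms by (subst floor_unique[of "n + 1"]) auto
    then show ?thesis using assms(1)[of "y - of_int n - 1"] 3 assms(2,4) by (simp add: frac_def) (simp add: algebra_simps)
  qed
qed

lemma floor_frac_deriv:
  fixes p :: "real \<Rightarrow> real"
  assumes "\<And>x. \<bar>x\<bar> < \<eta> \<Longrightarrow> p (x + 1) = p x + c" "0 < \<eta>" "\<eta> \<le> 1"
    and p': "\<And>x. (p has_real_derivative p' x) (at x)"
  shows "((\<lambda>x. p (frac x) + c * of_int \<lfloor>x\<rfloor>) has_real_derivative p' (frac x)) (at x)"
proof -
  let ?n = "\<lfloor>x\<rfloor>"
  have "((\<lambda>y. p (y - of_int ?n) + c * of_int ?n) has_real_derivative p' (x - of_int ?n) * 1 + 0) (at x)"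
    by (intro DERIV_add DERIV_const DERIV_chain2[OF p']) (auto intro!: derivative_eq_intros)
  then have "((\<lambda>x. p (frac x) + c * of_int \<lfloor>x\<rfloor>) has_real_derivative p' (x - of_int ?n) * 1 + 0) (at x)"
  proof (rule has_field_derivative_transform_within_open)
    show "open {of_int ?n - \<eta> <..< of_int ?n + 1 + \<eta>}" by simp
    show "x \<in> {of_int ?n - \<eta> <..< of_int ?n + 1 + \<eta>}" using assms by (auto; linarith)
    show "p (y - of_int ?n) + c * of_int ?n = p (frac y) + c * of_int \<lfloor>y\<rfloor>"
      if "y \<in> {of_int ?n - \<eta> <..< of_int ?n + 1 + \<eta>}" for y
      using floor_frac_local[where p=p and c=c and y=y and n="?n", OF assms(1,3)] that by auto
  qed
  then show ?thesis by (simp add: frac_def)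
qed

text \<open>The constant c is generalised because differentiation turns the rule with c into the
  rule with 0.\<close>

lemma ndiff_floor_frac:
  fixes p :: "real \<Rightarrow> real"
  assumes "\<And>x. \<bar>x\<bar> < \<eta> \<Longrightarrow> p (x + 1) = p x + c" "0 < \<eta>" "\<eta> \<le> 1" "ndiff n p"
  shows "ndiff n (\<lambda>x. p (frac x) + c * of_int \<lfloor>x\<rfloor>)"
  using assms
proof (induction n arbitrary: p c)
  case (Suc n)
  obtain p' where p': "\<And>x. (p has_real_derivative p' x) (at x)" "ndiff n p'"
    using ndiff_SucD[OF Suc.prems(4)] by blast
  have "p' (x + 1) = p' x + 0" if "\<bar>x\<bar> < \<eta>" for x
  proof -
    have "((\<lambda>x. p x + c) has_real_derivative p' x + 0) (at x)"
      by (intro DERIV_add DERIV_const p')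
    then have "((\<lambda>x. p (x + 1)) has_real_derivative p' x + 0) (at x)"
      by (rule has_field_derivative_transform_within_open[of _ _ _ "{- \<eta><..<\<eta>}"])
        (use that Suc.prems in auto)
    moreover have "((\<lambda>x. p (x + 1)) has_real_derivative p' (x + 1) * 1) (at x)"
      by (rule DERIV_chain2[OF p'(1)]) (auto intro!: derivative_eq_intros)
    ultimately show ?thesis using DERIV_unique by fastforce
  qed
  from Suc.IH[of p' 0, OF this Suc.prems(2,3) p'(2)] floor_frac_deriv[where p=p and c=c, OF Suc.prems(1-3) p'(1)]
  show ?case by (intro ndiff_SucI) auto
qed simp

definition circ_ext :: "(real \<Rightarrow> real) \<Rightarrow> real \<Rightarrow> real" where
  "circ_ext p x = p (frac x) + of_int \<lfloor>x\<rfloor>"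

lemma circ_ext_translate: "circ_ext p (x + 1) = circ_ext p x + 1"
  by (simp add: circ_ext_def frac_def)

lemma circ_ext_eq: "0 \<le> x \<Longrightarrow> x < 1 \<Longrightarrow> circ_ext p x = p x"
  by (simp add: circ_ext_def frac_eq floor_eq_iff)

lemma lift_diffeo_circ_ext:
  fixes p :: "real \<Rightarrow> real"
  assumes "\<And>x. \<bar>x\<bar> < \<eta> \<Longrightarrow> p (x + 1) = p x + 1" "0 < \<eta>" "\<eta> \<le> 1" "smooth p"
    "\<And>x. (p has_real_derivative p' x) (at x)" "\<And>x. p' x > 0"
  shows "lift_diffeo (circ_ext p)"
proof -
  have eq: "circ_ext p = (\<lambda>x. p (frac x) + 1 * of_int \<lfloor>x\<rfloor>)" by (auto simp: circ_ext_def)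
  have "smooth (circ_ext p)"
    using ndiff_floor_frac[where p=p and c=1, OF assms(1-3)] assms(4) unfolding smooth_def eq by blast
  moreover have "(circ_ext p has_real_derivative p' (frac x)) (at x)" for x
    unfolding eq using floor_frac_deriv[where p=p and c=1, OF assms(1-3,5)] by simp
  ultimately show ?thesis
    unfolding lift_diffeo_def using assms(6) circ_ext_translate
    by (intro conjI exI[of _ "\<lambda>x. p' (frac x)"] allI) auto
qed

text \<open>Piecewise linear maps with smoothed corners: the slope increases by d at the corner c.\<close>

definition bent :: "real \<Rightarrow> real \<Rightarrow> (real \<times> real) list \<Rightarrow> real \<Rightarrow> real" where
  "bent a s bs x = a + s * x + (\<Sum>(c, d)\<leftarrow>bs. d * ramp (x - c))"

definition dbent :: "real \<Rightarrow> (real \<times> real) list \<Rightarrow> real \<Rightarrow> real" where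
  "dbent s bs x = s + (\<Sum>(c, d)\<leftarrow>bs. d * dramp (x - c))"

lemma bent_deriv: "(bent a s bs has_real_derivative dbent s bs x) (at x)"
proof -
  have *: "((\<lambda>x. d * ramp (x - c)) has_real_derivative d * (dramp (x - c) * 1)) (at x)" for c d
    by (intro DERIV_cmult DERIV_chain2[OF ramp_deriv]) (auto intro!: derivative_eq_intros)
  have "((\<lambda>x. \<Sum>(c, d)\<leftarrow>bs. d * ramp (x - c)) has_real_derivative
      (\<Sum>(c, d)\<leftarrow>bs. d * dramp (x - c))) (at x)"
    by (induction bs) (use DERIV_add[OF *] in \<open>auto simp: case_prod_beta\<close>)
  moreover have "((\<lambda>x. a + s * x) has_real_derivative s) (at x)"
    by (auto intro!: derivative_eq_intros)
  ultimately show ?thesis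
    unfolding bent_def dbent_def using DERIV_add by blast
qed

lemma smooth_bent: "smooth (bent a s bs)"
proof -
  have "smooth (\<lambda>x. \<Sum>(c, d)\<leftarrow>bs. d * ramp (x - c))"
  proof (induction bs)
    case (Cons b bs)
    have "smooth (\<lambda>x. snd b * ramp (x - fst b))"
      by (intro smooth_mult smooth_const smooth_compose[OF smooth_ramp] smooth_diff smooth_ident)
    from smooth_add[OF this Cons] show ?case by (simp add: case_prod_beta)
  qed (simp add: smooth_const)
  then show ?thesis
    unfolding bent_def by (intro smooth_add smooth_mult smooth_const smooth_ident)
qed

text \<open>Smoothings of the piecewise linear maps with slope 1/4 on \<open>[-2/5, 2/5]\<close> and 4 elsewhere; with slope 2
  on \<open>[-1/6, 1/12]\<close> and 2/3 elsewhere; and with slopes 16, 1, 4 (around \<open>C\<close>), 2/3 (on the gap to its right), 1/16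
  (elsewhere).\<close>

definition T_map :: "real \<Rightarrow> real" where
  "T_map = circ_ext (bent 0 (1/4) [(2/5, 15/4), (3/5, -15/4)])"

definition W_map :: "real \<Rightarrow> real" where
  "W_map = circ_ext (bent 0 2 [(1/12, -4/3), (5/6, 4/3)])"

definition P_map :: "real \<Rightarrow> real" where
  "P_map = circ_ext (bent (-2/3) 16
     [(1/30, -15), (1/18, 3), (41/360, -10/3), (1/3, -29/48), (1375/1377, 255/16)])"

lemma T_map_lift_diffeo: "lift_diffeo T_map"
  unfolding T_map_def
proof (rule lift_diffeo_circ_ext[where \<eta>="1/2000", OF _ _ _ smooth_bent bent_deriv])
  fix x :: real
  \<comment> \<open>Near 0 the translation rule expresses that the slopes integrate to 1 over a
    period.\<close>
  show "bent 0 (1/4) [(2/5, 15/4), (3/5, -15/4)] (x + 1) = bent 0 (1/4) [(2/5, 15/4), (3/5, -15/4)] x + 1"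
    if "\<bar>x\<bar> < 1 / 2000"
    using that by (simp add: bent_def ramp_left ramp_right; simp add: field_simps)
  show "0 < dbent (1/4) [(2/5, 15/4), (3/5, -15/4)] x"
    using dramp_left[of "x - 3/5"] dramp_right[of "x - 2/5"] dramp_bounds[of "x - 2/5"] dramp_bounds[of "x - 3/5"]
    by (cases "x \<le> 1/2") (auto simp: dbent_def)
qed simp_all

lemma W_map_lift_diffeo: "lift_diffeo W_map"
  unfolding W_map_def
proof (rule lift_diffeo_circ_ext[where \<eta>="1/2000", OF _ _ _ smooth_bent bent_deriv])
  fix x :: real
  show "bent 0 2 [(1/12, -4/3), (5/6, 4/3)] (x + 1) = bent 0 2 [(1/12, -4/3), (5/6, 4/3)] x + 1"
    if "\<bar>x\<bar> < 1 / 2000"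
    using that by (simp add: bent_def ramp_left ramp_right; simp add: field_simps)
  show "0 < dbent 2 [(1/12, -4/3), (5/6, 4/3)] x"
    using dramp_bounds[of "x - 1/12"] dramp_bounds[of "x - 5/6"] by (auto simp: dbent_def)
qed simp_all

lemma P_map_lift_diffeo: "lift_diffeo P_map"
  unfolding P_map_def
proof (rule lift_diffeo_circ_ext[where \<eta>="1/2000", OF _ _ _ smooth_bent bent_deriv])
  fix x :: real
  let ?bs = "[(1/30, -15), (1/18, 3), (41/360, -10/3), (1/3, -29/48), (1375/1377, 255/16)] :: (real \<times> real) list"
  \<comment> \<open>The last corner 1375/1377 is placed so that the total rise over a period is
    exactly 1.\<close>
  show "bent (-2/3) 16 ?bs (x + 1) = bent (-2/3) 16 ?bs x + 1" if "\<bar>x\<bar> < 1 / 2000"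
    using that by (simp add: bent_def ramp_left ramp_right; simp add: field_simps)
  note b = dramp_bounds[of "x - 1/30"] dramp_bounds[of "x - 1/18"] dramp_bounds[of "x - 41/360"]
    dramp_bounds[of "x - 1/3"] dramp_bounds[of "x - 1375/1377"]
  \<comment> \<open>In each range at most one corner is being rounded; all other
    \<open>dramp\<close> terms are 0 or 1.\<close>
  consider "x \<le> 1/20" | "1/20 \<le> x" "x \<le> 1/10" | "1/10 \<le> x" "x \<le> 1/5" | "1/5 \<le> x" "x \<le> 1/2" | "1/2 \<le> x"
    by linarith
  then show "0 < dbent 16 ?bs x"
    by cases (use b in \<open>simp_all add: dbent_def dramp_left dramp_right\<close>)
qed simp_all

section \<open>Values of the model maps on their affine pieces\<close>

lemma T_map_translate: "T_map (x + 1) = T_map x + 1"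
  and W_map_translate: "W_map (x + 1) = W_map x + 1"
  by (simp_all add: T_map_def W_map_def circ_ext_translate)

lemma T_map_contract:
  assumes "\<bar>x\<bar> \<le> 399/1000" shows "T_map x = x / 4"
proof (cases "x < 0")
  case True
  have "T_map x = T_map (x + 1) - 1" by (simp add: T_map_translate)
  then show ?thesis using True assms
    by (simp add: T_map_def circ_ext_eq bent_def ramp_left ramp_right; simp add: field_simps)
next
  case False
  then show ?thesis using assms
    by (simp add: T_map_def circ_ext_eq bent_def ramp_left ramp_right)
qed

lemma T_map_expand: "401/1000 \<le> x \<Longrightarrow> x \<le> 599/1000 \<Longrightarrow> T_map x = 4 * x - 3/2"
  by (simp add: T_map_def circ_ext_eq bent_def ramp_left ramp_right; simp add: field_simps)

lemma W_map_contract: "1/10 \<le> x \<Longrightarrow> x \<le> 4/5 \<Longrightarrow> W_map x = 2/3 * x + 1/9"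
  by (simp add: W_map_def circ_ext_eq bent_def ramp_left ramp_right; simp add: field_simps)

lemma W_map_0: "W_map 0 = 0"
  by (simp add: W_map_def circ_ext_eq bent_def ramp_left ramp_right; simp add: field_simps)

text \<open>Modulo 1, slope 16 on the left quarter of C and slope 4 on the right quarter spread C
  alone over all three sets C + j/3. As 1/9 is fixed and 1 goes to 1/3, the rest of the circle is
  pushed into the gap between 1/9 and 1/3, where slope 2/3 serves the blender.\<close>

lemma P_map_values:
  "0 \<le> x \<Longrightarrow> x \<le> 1/36 \<Longrightarrow> P_map x = 16 * x - 2/3"
  "1/12 \<le> x \<Longrightarrow> x \<le> 1/9 \<Longrightarrow> P_map x = 4 * x - 1/3"
  "7/60 \<le> x \<Longrightarrow> x \<le> 59/180 \<Longrightarrow> P_map x = 2/3 * x + 5/108"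
  "P_map (499/500) < 32/100"
  by ((simp add: P_map_def circ_ext_eq bent_def ramp_left ramp_right; simp add: field_simps)+)

section \<open>Words of lifts and iterates of the skew product\<close>

text \<open>The dynamics is carried out on the line: words act as \<open>fold G w\<close>, first
  letter first, and the circle is recovered through integer translates.\<close>

definition hlift :: "(real \<Rightarrow> real) \<Rightarrow> bool" where
  "hlift F \<longleftrightarrow> (\<forall>x. F (x + 1) = F x + 1) \<and> strict_mono F \<and> continuous_on UNIV F"

definition hlifts :: "nat \<Rightarrow> (nat \<Rightarrow> real \<Rightarrow> real) \<Rightarrow> bool" where
  "hlifts k G \<longleftrightarrow> (\<forall>i\<in>{1..k}. hlift (G i))"

lemma circ_diff_hlift:
  assumes "circ_diff r F" shows "hlift F"
proof -
  have "Ck r F" using assms by (auto simp: circ_diff_def)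
  then have "continuous_on UNIV ((deriv ^^ 0) F)"
    unfolding Ck_def by (metis enat_0 zero_le)
  then show ?thesis using assms by (auto simp: circ_diff_def hlift_def)
qed

lemma hlift_compose: "hlift F \<Longrightarrow> hlift G \<Longrightarrow> hlift (\<lambda>x. G (F x))"
  unfolding hlift_def by (auto simp: strict_mono_def intro: continuous_on_compose2[of UNIV G])

lemma hlift_fold:
  assumes "hlifts k G" "set w \<subseteq> {1..k}"
  shows "hlift (fold G w)"
  using assms(2)
proof (induction w)
  case Nil
  then show ?case by (simp add: hlift_def strict_mono_def id_def)
next
  case (Cons i w)
  then show ?case using assms(1) hlift_compose[of "G i" "fold G w"] by (auto simp: hlifts_def comp_def)
qed

lemma hlift_translate: "hlift F \<Longrightarrow> F (x + of_int n) = F x + of_int n"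
  using translate_int[of F] by (simp add: hlift_def)

lemma hlift_surj: "hlift F \<Longrightarrow> \<exists>x. F x = y"
  using translates_surj[of F] by (simp add: hlift_def)

lemma hlift_less_iff: "hlift F \<Longrightarrow> F x < F y \<longleftrightarrow> x < y"
  by (simp add: hlift_def strict_mono_less)

lemma hlift_le_iff: "hlift F \<Longrightarrow> F x \<le> F y \<longleftrightarrow> x \<le> y"
  by (simp add: hlift_def strict_mono_less_eq)

lemma frac_int_eqI: "x = y + of_int n \<Longrightarrow> frac x = frac (y::real)"
  by (simp add: frac_def)

lemma frac_eqE:
  assumes "frac x = frac (y::real)" obtains n :: int where "x = y + of_int n"
proof
  show "x = y + of_int (\<lfloor>x\<rfloor> - \<lfloor>y\<rfloor>)" using assms by (simp add: frac_def)
qed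

lemma frac_hlift_frac: "hlift F \<Longrightarrow> frac (F (frac x)) = frac (F x)"
  by (rule frac_int_eqI[of _ _ "- \<lfloor>x\<rfloor>"]) (use hlift_translate[of F x "- \<lfloor>x\<rfloor>"] in \<open>simp add: frac_def\<close>)

lemma skew_iterate:
  assumes G: "hlifts k G" and \<omega>: "\<omega> \<in> Sigma_k k" and x: "x \<in> circ"
  shows "(skew G ^^ n) (\<omega>, x) =
    (\<lambda>i. \<omega> (i + int n), frac (fold G (map (\<lambda>j. \<omega> (int j)) [0..<n]) x))"
proof (induction n)
  case 0
  then show ?case using x by (simp add: circ_def frac_eq)
next
  case (Suc n)
  have "hlift (G (\<omega> (int n)))" using G \<omega> by (auto simp: hlifts_def Sigma_k_def)
  moreover have "(skew G ^^ Suc n) (\<omega>, x) = skew G ((skew G ^^ n) (\<omega>, x))" by simp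
  ultimately show ?case
    by (simp only: Suc) (simp add: skew_def shift_def frac_hlift_frac algebra_simps)
qed

section \<open>Cylinders, arcs and density in the phase space\<close>

lemma seqdist_less:
  assumes "\<And>i. \<bar>i\<bar> \<le> int m \<Longrightarrow> \<omega> i = \<omega>' i" "\<nu> ^ m < \<epsilon>" "0 < \<nu>" "\<nu> < 1" "0 < \<epsilon>"
  shows "seqdist \<nu> \<omega> \<omega>' < \<epsilon>"
proof (cases "\<omega> = \<omega>'")
  case False
  define P where "P = (\<lambda>m::nat. \<omega> (int m) \<noteq> \<omega>' (int m) \<or> \<omega> (- int m) \<noteq> \<omega>' (- int m))"
  from False obtain i where "\<omega> i \<noteq> \<omega>' i" by blast
  then have "P (nat \<bar>i\<bar>)" by (cases "i \<ge> 0") (auto simp: P_def)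
  then have "P (LEAST m. P m)" by (rule LeastI)
  then have "\<not> (LEAST m. P m) \<le> m" using assms(1) by (auto simp: P_def)
  then have "\<nu> ^ (LEAST m. P m) \<le> \<nu> ^ m" using assms by (intro power_decreasing) auto
  then show ?thesis using False assms(2) by (simp add: seqdist_def P_def)
qed (use assms in \<open>simp add: seqdist_def\<close>)

lemma cdist_less_iff: "cdist a b < \<epsilon> \<longleftrightarrow> (\<exists>n::int. \<bar>a - b - of_int n\<bar> < \<epsilon>)"
proof
  assume "cdist a b < \<epsilon>"
  then consider "frac (a - b) < \<epsilon>" | "1 - frac (a - b) < \<epsilon>" unfolding cdist_def by linarith
  then show "\<exists>n::int. \<bar>a - b - of_int n\<bar> < \<epsilon>"
  proof cases
    case 1
    then show ?thesis by (intro exI[of _ "\<lfloor>a - b\<rfloor>"]) (simp add: frac_def)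
  next
    case 2
    then show ?thesis using frac_lt_1[of "a - b"]
      by (intro exI[of _ "\<lfloor>a - b\<rfloor> + 1"]) (simp add: frac_def)
  qed
next
  assume "\<exists>n::int. \<bar>a - b - of_int n\<bar> < \<epsilon>"
  then obtain n :: int where "\<bar>a - b - of_int n\<bar> < \<epsilon>" ..
  moreover define m where "m = \<lfloor>a - b\<rfloor> - n"
  ultimately have m: "\<bar>frac (a - b) + of_int m\<bar> < \<epsilon>" by (simp add: frac_def)
  have "m \<ge> 0 \<or> m \<le> -1" by linarith
  then have "real_of_int m \<ge> 0 \<or> real_of_int m \<le> -1" by linarith
  then show "cdist a b < \<epsilon>"
    using m frac_lt_1[of "a - b"] frac_ge_0[of "a - b"] unfolding cdist_def by linarith
qed

text \<open>Cylinders times arcs form a basis: once \<open>\<nu> ^ m < \<epsilon>\<close>, agreement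
  on indices up to m in absolute value gives \<epsilon>-closeness of sequences.\<close>

lemma dense_in_phaseI:
  assumes "0 < \<nu>" "\<nu> < 1"
    and A: "\<And>\<omega> m c d. \<omega> \<in> Sigma_k k \<Longrightarrow> c < d \<Longrightarrow>
      \<exists>q\<in>A. (\<forall>i. \<bar>i\<bar> \<le> int m \<longrightarrow> fst q i = \<omega> i) \<and> (\<exists>n::int. c < snd q + of_int n \<and> snd q + of_int n < d)"
  shows "dense_in_phase k \<nu> A"
  unfolding dense_in_phase_def
proof (intro ballI allI impI)
  fix p and \<epsilon> :: real assume p: "p \<in> phase k" and "0 < \<epsilon>"
  obtain m where m: "\<nu> ^ m < \<epsilon>" using real_arch_pow_inv \<open>0 < \<epsilon>\<close> \<open>\<nu> < 1\<close> by blast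
  obtain q and n :: int where q: "q \<in> A" "\<And>i. \<bar>i\<bar> \<le> int m \<Longrightarrow> fst q i = fst p i"
    "snd p - \<epsilon> < snd q + of_int n" "snd q + of_int n < snd p + \<epsilon>"
    using A[of "fst p" "snd p - \<epsilon>" "snd p + \<epsilon>" m] p \<open>0 < \<epsilon>\<close> by (force simp: phase_def)
  have "seqdist \<nu> (fst p) (fst q) < \<epsilon>"
    using q(2) m assms \<open>0 < \<epsilon>\<close> by (intro seqdist_less[of m]) auto
  moreover have "cdist (snd p) (snd q) < \<epsilon>"
    unfolding cdist_less_iff using q(3,4) by (intro exI[of _ n]) linarith
  ultimately show "\<exists>q\<in>A. seqdist \<nu> (fst p) (fst q) < \<epsilon> \<and> cdist (snd p) (snd q) < \<epsilon>"
    using q(1) by blast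
qed

section \<open>Transitivity of the semigroup yields a dense orbit\<close>

definition trans_ifs :: "nat \<Rightarrow> (nat \<Rightarrow> real \<Rightarrow> real) \<Rightarrow> bool" where
  "trans_ifs k G \<longleftrightarrow> (\<forall>a b c d. a < b \<longrightarrow> c < d \<longrightarrow>
     (\<exists>w x. \<exists>n::int. set w \<subseteq> {1..k} \<and> a < x \<and> x < b \<and>
        c < fold G w x + of_int n \<and> fold G w x + of_int n < d))"

text \<open>Push the source forward by w and pull the target back by u; transitivity supplies the
  connecting word v, and openness leaves a whole closed interval of starting points.\<close>

lemma trans_ifs_refine:
  assumes G: "hlifts k G" "trans_ifs k G" and w: "set w \<subseteq> {1..k}" and u: "set u \<subseteq> {1..k}"
    and "a < b" "c < d"
  shows "\<exists>v a' b'. set v \<subseteq> {1..k} \<and> a \<le> a' \<and> a' < b' \<and> b' \<le> b \<and>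
    (\<forall>x\<in>{a'..b'}. \<exists>m::int. c < fold G (w @ v @ u) x + of_int m \<and> fold G (w @ v @ u) x + of_int m < d)"
proof -
  note hw = hlift_fold[OF G(1) w] and hu = hlift_fold[OF G(1) u]
  obtain c0 d0 where c0: "fold G u c0 = c" and d0: "fold G u d0 = d" using hlift_surj[OF hu] by metis
  then have "c0 < d0" using \<open>c < d\<close> hlift_less_iff[OF hu] by blast
  have "fold G w a < fold G w b" using \<open>a < b\<close> hlift_less_iff[OF hw] by blast
  then obtain v x and m :: int where v: "set v \<subseteq> {1..k}" "fold G w a < x" "x < fold G w b"
    "c0 < fold G v x + of_int m" "fold G v x + of_int m < d0"
    using G(2) \<open>c0 < d0\<close> unfolding trans_ifs_def by meson
  obtain y where y: "fold G w y = x" using hlift_surj[OF hw] by blast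
  define g where "g = fold G (w @ v @ u)"
  have hg: "hlift g" unfolding g_def using w u v by (intro hlift_fold[OF G(1)]) auto
  have y1: "a < y" "y < b" using v(2,3) hlift_less_iff[OF hw] unfolding y[symmetric] by blast+
  have gy: "g y + of_int m = fold G u (fold G v x + of_int m)"
    using hlift_translate[OF hu] by (simp add: g_def y)
  have y2: "c < g y + of_int m" "g y + of_int m < d"
    using v(4,5) unfolding gy c0[symmetric] d0[symmetric] hlift_less_iff[OF hu] .
  define S where "S = {z. a < z \<and> z < b \<and> c < g z + of_int m \<and> g z + of_int m < d}"
  have "open S"
    using hg unfolding hlift_def S_def
    by (intro open_Collect_conj open_Collect_less continuous_intros) auto
  moreover have "y \<in> S" using y1 y2 by (simp add: S_def)
  ultimately obtain e where e: "0 < e" "\<And>z. \<bar>z - y\<bar> < e \<Longrightarrow> z \<in> S"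
    unfolding open_dist dist_real_def by blast
  show ?thesis
  proof (rule exI[of _ v], rule exI[of _ "y - e/2"], rule exI[of _ "y + e/2"], intro conjI ballI)
    show "a \<le> y - e/2" "y + e/2 \<le> b"
      using e(2)[of "y - e/2"] e(2)[of "y + e/2"] e(1) by (auto simp: S_def)
    fix z assume "z \<in> {y - e/2..y + e/2}"
    then show "\<exists>m::int. c < fold G (w @ v @ u) z + of_int m \<and> fold G (w @ v @ u) z + of_int m < d"
      using e(2)[of z] e(1) unfolding S_def g_def by (intro exI[of _ m]) auto
  qed (use e v in auto)
qed

text \<open>All finite patterns (past block, future block, arc with rational end points) are visited in turn;
  the interval of admissible starting points shrinks while the initial word grows.\<close>

lemma has_dense_orbitI:
  assumes G: "hlifts k G" "trans_ifs k G" and \<nu>: "0 < \<nu>" "\<nu> < 1" and k: "k \<ge> 1"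
  shows "has_dense_orbit k \<nu> G"
proof -
  \<comment> \<open>\<open>from_nat\<close> enumerates all patterns, so every pattern is treated at
    some stage.\<close>
  define tgt :: "nat \<Rightarrow> nat list \<times> nat list \<times> rat \<times> rat" where "tgt = from_nat"
  \<comment> \<open>The orbit must be in the arc right after \<open>w @ v1 @ u\<close>, when u is
    the recent past and v the near future. The final letter 1 makes the word grow even if u and v
    are empty.\<close>
  define hits where "hits = (\<lambda>n w w' a' b'. \<forall>u v c d. tgt n = (u, v, c, d) \<longrightarrow> set u \<subseteq> {1..k} \<longrightarrow>
      set v \<subseteq> {1..k} \<longrightarrow> c < d \<longrightarrow> (\<exists>v1. w' = w @ v1 @ u @ v @ [1::nat] \<and>
      (\<forall>x\<in>{a'..b'::real}. \<exists>m::int. of_rat c < fold G (w @ v1 @ u) x + of_int m \<and>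
         fold G (w @ v1 @ u) x + of_int m < of_rat d)))"
  define Q where "Q = (\<lambda>n (s :: nat list \<times> real \<times> real) (s' :: nat list \<times> real \<times> real).
     case s of (w, a, b) \<Rightarrow> case s' of (w', a', b') \<Rightarrow>
       (\<exists>v. w' = w @ v \<and> v \<noteq> []) \<and> a \<le> a' \<and> b' \<le> b \<and> hits n w w' a' b')"
  define P where "P = (\<lambda>s :: nat list \<times> real \<times> real. case s of (w, a, b) \<Rightarrow> set w \<subseteq> {1..k} \<and> a < b)"
  have step: "\<exists>s'. P s' \<and> Q n s s'" if "P s" for n s
  proof -
    obtain w a b where s: "s = (w, a, b)" by (cases s)
    obtain u v c d where t: "tgt n = (u, v, c, d)" by (cases "tgt n")
    have w: "set w \<subseteq> {1..k}" "a < b" using that by (auto simp: P_def s)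
    show ?thesis
    proof (cases "set u \<subseteq> {1..k} \<and> set v \<subseteq> {1..k} \<and> c < d")
      case True
      then have "real_of_rat c < of_rat d" by (simp add: of_rat_less)
      from trans_ifs_refine[OF G w(1) _ w(2) this, of u] True
      obtain v1 a' b' where *: "set v1 \<subseteq> {1..k}" "a \<le> a'" "a' < b'" "b' \<le> b"
        "\<forall>x\<in>{a'..b'}. \<exists>m::int. of_rat c < fold G (w @ v1 @ u) x + of_int m \<and>
         fold G (w @ v1 @ u) x + of_int m < of_rat d" by blast
      then have "P (w @ v1 @ u @ v @ [1], a', b')" using True w k by (auto simp: P_def)
      moreover have "Q n s (w @ v1 @ u @ v @ [1], a', b')"
        using * t by (auto simp: Q_def s hits_def)
      ultimately show ?thesis by blast
    next
      case False
      then have "P (w @ [1], a, b)" "Q n s (w @ [1], a, b)"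
        using w k t by (auto simp: P_def Q_def s hits_def)
      then show ?thesis by blast
    qed
  qed
  have "P ([], 0, 1)" by (simp add: P_def)
  then obtain s where s: "\<And>n. P (s n)" "\<And>n. Q n (s n) (s (Suc n))"
    using dependent_nat_choice[of "\<lambda>_. P" Q] step by metis
  define W where "W n = fst (s n)" for n
  define a where "a n = fst (snd (s n))" for n
  define b where "b n = snd (snd (s n))" for n
  have sn: "s n = (W n, a n, b n)" for n by (simp add: W_def a_def b_def)
  have WP: "set (W n) \<subseteq> {1..k}" "a n < b n" for n using s(1)[of n] by (auto simp: P_def sn)
  have WQ: "\<exists>v. W (Suc n) = W n @ v \<and> v \<noteq> []" "a n \<le> a (Suc n)" "b (Suc n) \<le> b n"
    "hits n (W n) (W (Suc n)) (a (Suc n)) (b (Suc n))" for n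
    using s(2)[of n] by (auto simp: Q_def sn)
  have amono: "a m \<le> a n" and bmono: "b n \<le> b m" if "m \<le> n" for m n
    using lift_Suc_mono_le[of a, OF WQ(2) that] lift_Suc_antimono_le[of b, OF WQ(3) that] by auto
  have ab: "a m \<le> b n" for m n
    using amono[of m "max m n"] bmono[of n "max m n"] WP(2)[of "max m n"] by simp
  \<comment> \<open>A common point of the nested closed intervals, hence a starting point that makes
    all visits.\<close>
  define x where "x = (SUP n. a n)"
  have x: "a n \<le> x" "x \<le> b n" for n
    unfolding x_def using ab by (auto intro!: cSUP_upper cSUP_least bdd_aboveI2[of _ _ "b 0"])
  have pre: "\<exists>v. W n = W m @ v" if "m \<le> n" for m n
    using that
  proof (induction n rule: dec_induct)
    case (step n)
    then show ?case using WQ(1)[of n] by force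
  qed simp
  have len: "n \<le> length (W n)" for n
  proof (induction n)
    case (Suc n)
    obtain v where "W (Suc n) = W n @ v" "v \<noteq> []" using WQ(1) by blast
    then show ?case using Suc by (cases v) auto
  qed simp
  \<comment> \<open>The past is filled with the symbol 1, as the visits are arranged in forward
    time. Symbol i is read from stage i + 1, whose word has length at least i + 1.\<close>
  define \<omega> where "\<omega> = (\<lambda>i::int. if i < 0 then 1 else W (Suc (nat i)) ! nat i)"
  have \<omega>_W: "\<omega> (int j) = W n ! j" if "j < length (W n)" for j n
  proof -
    have j: "j < length (W (Suc j))" using len[of "Suc j"] by simp
    have "W n ! j = W (Suc j) ! j"
      using pre[of n "Suc j"] pre[of "Suc j" n] that j by (cases "n \<le> Suc j") (auto simp: nth_append)
    then show ?thesis by (simp add: \<omega>_def)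
  qed
  have \<omega>: "\<omega> \<in> Sigma_k k"
  proof -
    have "\<omega> i \<in> {1..k}" for i
    proof (cases "i < 0")
      case False
      have "nat i < length (W (Suc (nat i)))" using len[of "Suc (nat i)"] by simp
      then show ?thesis using False WP(1)[of "Suc (nat i)"] nth_mem by (force simp: \<omega>_def)
    qed (use k in \<open>simp add: \<omega>_def\<close>)
    then show ?thesis by (simp add: Sigma_k_def)
  qed
  have p: "(\<omega>, frac x) \<in> phase k" using \<omega> by (simp add: phase_def circ_def frac_lt_1)
  have "dense_in_phase k \<nu> (orbit k G (\<omega>, frac x))"
  proof (rule dense_in_phaseI[OF \<nu>])
    fix \<eta> m and c d :: real assume \<eta>: "\<eta> \<in> Sigma_k k" and "c < d"
    obtain c' where c': "c < of_rat c'" "of_rat c' < d" using of_rat_dense[OF \<open>c < d\<close>] by blast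
    obtain d' where d': "real_of_rat c' < of_rat d'" "of_rat d' < d" using of_rat_dense[OF c'(2)] by blast
    \<comment> \<open>u covers the indices -m to -1 and v the indices 0 to m, hence the different
      lengths.\<close>
    define u where "u = map (\<lambda>j. \<eta> (int j - int m)) [0..<m]"
    define v where "v = map (\<lambda>j. \<eta> (int j)) [0..<Suc m]"
    have uv: "set u \<subseteq> {1..k}" "set v \<subseteq> {1..k}" using \<eta> by (auto simp: u_def v_def Sigma_k_def)
    obtain n where n: "tgt n = (u, v, c', d')" unfolding tgt_def by (metis from_nat_to_nat)
    obtain v1 where v1: "W (Suc n) = W n @ v1 @ u @ v @ [1]"
      "\<forall>x\<in>{a (Suc n)..b (Suc n)}. \<exists>m::int. of_rat c' < fold G (W n @ v1 @ u) x + of_int m \<and>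
         fold G (W n @ v1 @ u) x + of_int m < of_rat d'"
      using WQ(4)[of n] n uv d'(1) unfolding hits_def by (auto simp: of_rat_less)
    define z where "z = W n @ v1 @ u"
    have Wz: "W (Suc n) = z @ v @ [1]" using v1 by (simp add: z_def)
    define q where "q = (skew G ^^ length z) (\<omega>, frac x)"
    have "map (\<lambda>j. \<omega> (int j)) [0..<length z] = z"
      by (rule nth_equalityI) (use \<omega>_W[of _ "Suc n"] in \<open>auto simp: Wz nth_append\<close>)
    then have q: "q = (\<lambda>i. \<omega> (i + int (length z)), frac (fold G z (frac x)))"
      using skew_iterate[OF G(1) \<omega>] p by (simp add: q_def phase_def)
    have z: "set z \<subseteq> {1..k}" using WP(1)[of "Suc n"] by (simp add: Wz)
    have q2: "snd q = frac (fold G z x)"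
      using frac_hlift_frac[OF hlift_fold[OF G(1) z]] by (simp add: q)
    have "q \<in> phase k" using \<omega> by (simp add: q phase_def Sigma_k_def circ_def frac_lt_1)
    then have "q \<in> orbit k G (\<omega>, frac x)" by (auto simp: orbit_def q_def)
    moreover have "fst q i = \<eta> i" if "\<bar>i\<bar> \<le> int m" for i
    proof (cases "i < 0")
      case True
      define L where "L = length (W n @ v1)"
      define j where "j = nat (i + int m)"
      have j: "i + int (length z) = int (L + j)" "j < m"
        using that True by (simp_all add: j_def L_def z_def u_def)
      have "W (Suc n) ! (L + j) = (u @ v @ [1]) ! j"
        unfolding v1(1) L_def append_assoc[symmetric, of "W n" v1] by (rule nth_append_length_plus)
      also have "\<dots> = \<eta> i" using that True j(2) by (simp add: nth_append u_def j_def)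
      finally show ?thesis using \<omega>_W[of "L + j" "Suc n"] j by (simp add: q v1(1) L_def u_def)
    next
      case False
      define j where "j = nat i + length z"
      have j: "i + int (length z) = int j" using False by (simp add: j_def)
      have "j < length (W (Suc n))" using that False by (simp add: Wz v_def j_def)
      moreover have "W (Suc n) ! j = \<eta> i"
        using that False nat_less_iff[of i "Suc m"] by (simp add: Wz j_def nth_append v_def del: upt_Suc)
      ultimately show ?thesis using \<omega>_W[of j "Suc n"] j by (simp add: q)
    qed
    moreover have "\<exists>l::int. c < snd q + of_int l \<and> snd q + of_int l < d"
    proof -
      obtain l :: int where "of_rat c' < fold G z x + of_int l" "fold G z x + of_int l < of_rat d'"
        using bspec[OF v1(2), of x] x[of "Suc n"] unfolding z_def by fastforce
      then show ?thesis using c' d' unfolding q2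
        by (intro exI[of _ "l + \<lfloor>fold G z x\<rfloor>"]) (simp add: frac_def)
    qed
    ultimately show "\<exists>q\<in>orbit k G (\<omega>, frac x). (\<forall>i. \<bar>i\<bar> \<le> int m \<longrightarrow> fst q i = \<eta> i) \<and>
        (\<exists>n::int. c < snd q + of_int n \<and> snd q + of_int n < d)" by blast
  qed
  then show ?thesis unfolding has_dense_orbit_def using p by blast
qed

section \<open>Perturbations in the \<open>C\<^sup>r\<close> distance\<close>

text \<open>C^1 closeness of lifts without derivatives: the second clause is a Lipschitz bound on H
  - F, which controls the slopes of H wherever F is affine.\<close>

definition near :: "real \<Rightarrow> (real \<Rightarrow> real) \<Rightarrow> (real \<Rightarrow> real) \<Rightarrow> bool" where
  "near \<epsilon> F H \<longleftrightarrow> (\<forall>x. \<bar>H x - F x\<bar> \<le> \<epsilon>) \<and>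
     (\<forall>x y. \<bar>(H x - F x) - (H y - F y)\<bar> \<le> \<epsilon> * \<bar>x - y\<bar>)"

lemma funpow_deriv_periodic:
  assumes "\<And>x. F (x + 1) = F x + (1::real)" "j \<ge> 1"
  shows "(deriv ^^ j) F (x + 1) = (deriv ^^ j) F (x::real)"
proof -
  have *: "deriv f (x + 1) = deriv f x" if "\<And>x. f (x + 1) = f x + c" for f :: "real \<Rightarrow> real" and c x
  proof -
    have "(f has_real_derivative D) (at (x + 1)) \<longleftrightarrow> (f has_real_derivative D) (at x)" for D
    proof -
      have "(f has_real_derivative D) (at (x + 1)) \<longleftrightarrow> ((\<lambda>x. f x + c) has_real_derivative D) (at x)"
        unfolding DERIV_shift using that by simp
      also have "\<dots> \<longleftrightarrow> (f has_real_derivative D) (at x)"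
        using DERIV_add[OF _ DERIV_const[of "- c"], of "\<lambda>x. f x + c" D x UNIV]
          DERIV_add[OF _ DERIV_const[of c], of f D x UNIV] by auto
      finally show ?thesis .
    qed
    then show ?thesis unfolding deriv_def by simp
  qed
  show ?thesis using assms(2)
  proof (induction j arbitrary: x rule: dec_induct)
    case base
    then show ?case using *[of F 1] assms(1) by simp
  next
    case (step j)
    then show ?case using *[of "(deriv ^^ j) F" 0] by simp
  qed
qed

text \<open>Periodicity reduces the range to that over the compact interval [0, 1]. Boundedness is
  what makes the real supremum in \<open>dj\<close> an upper bound.\<close>

lemma dj_bdd:
  assumes "circ_diff r F" "circ_diff r G" "enat j \<le> r" "j \<ge> 1"
  shows "bdd_above (range (\<lambda>x. \<bar>(deriv ^^ j) F x - (deriv ^^ j) G x\<bar>))"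
proof -
  let ?D = "\<lambda>x. \<bar>(deriv ^^ j) F x - (deriv ^^ j) G x\<bar>"
  have per: "?D (x + 1) = ?D x" for x
    using assms funpow_deriv_periodic[of F j x] funpow_deriv_periodic[of G j x]
    by (simp add: circ_diff_def)
  have "?D x = ?D (frac x)" for x
  proof -
    have n: "?D (x + of_nat n) = ?D x" for n x
    proof (induction n)
      case (Suc n)
      then show ?case using per[of "x + of_nat n"] by (simp add: algebra_simps)
    qed simp
    show ?thesis
      using n[of "frac x" "nat \<lfloor>x\<rfloor>"] n[of x "nat (- \<lfloor>x\<rfloor>)"]
      by (cases "\<lfloor>x\<rfloor> \<ge> 0") (simp_all add: frac_def)
  qed
  moreover have "frac x \<in> {0..1}" for x :: real using frac_lt_1[of x] by simp
  ultimately have "range ?D \<subseteq> ?D ` {0..1}" by blast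
  moreover have "continuous_on {0..1} ?D"
    using assms by (intro continuous_intros) (auto simp: circ_diff_def Ck_def intro: continuous_on_subset)
  then have "bounded (?D ` {0..1})"
    by (intro compact_imp_bounded compact_continuous_image) auto
  ultimately show ?thesis by (meson bounded_imp_bdd_above bdd_above_mono)
qed

lemma cdist_bounds: "0 \<le> cdist a b" "cdist a b \<le> 1"
  using frac_lt_1[of "a - b"] frac_ge_0[of "a - b"] by (auto simp: cdist_def)

lemma cdist_le_dj0: "cdist (F x) (G x) \<le> dj 0 F G"
  unfolding dj_def using cdist_bounds by (auto intro!: cSUP_upper bdd_aboveI2[of _ _ 1])

lemma deriv_le_dj1:
  assumes "circ_diff r F" "circ_diff r G" "1 \<le> r"
  shows "\<bar>deriv F x - deriv G x\<bar> \<le> dj 1 F G"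
  using cSUP_upper[OF UNIV_I dj_bdd[OF assms(1,2), of 1], of x] assms(3)
  by (simp add: dj_def one_enat_def)

lemma dj_nonneg:
  assumes "circ_diff r F" "circ_diff r G" "enat j \<le> r"
  shows "0 \<le> dj j F G"
proof (cases "j = 0")
  case True
  then show ?thesis using cdist_le_dj0[of F 0 G] cdist_bounds[of "F 0" "G 0"] by simp
next
  case False
  then show ?thesis
    using cSUP_upper[OF UNIV_I dj_bdd[OF assms], of 0] by (auto simp: dj_def intro: order_trans[OF abs_ge_zero])
qed

text \<open>Halving \<epsilon> pays for the weight 1/2 of the first derivative in the series for r =
  \<infinity>; below 1/4 the cap \<open>min 1\<close> is inactive.\<close>

lemma dr_bounds:
  assumes FG: "circ_diff r F" "circ_diff r G" and r: "1 \<le> r"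
  shows "0 \<le> dr r F G"
    and "\<epsilon> \<le> 1/4 \<Longrightarrow> dr r F G < \<epsilon> / 2 \<Longrightarrow> dj 0 F G < \<epsilon> \<and> dj 1 F G < \<epsilon>"
proof -
  have "0 \<le> dr r F G \<and> (\<epsilon> \<le> 1/4 \<longrightarrow> dr r F G < \<epsilon> / 2 \<longrightarrow> dj 0 F G < \<epsilon> \<and> dj 1 F G < \<epsilon>)"
  proof (cases r)
    case (enat n)
    then have "1 \<le> n" using r by (simp add: one_enat_def)
    have "dj j F G \<le> dr r F G" if "j \<le> n" for j
      using that by (simp add: enat dr_def)
    from this[of 0] this[of 1] \<open>1 \<le> n\<close> dj_nonneg[OF FG, of 0] enat show ?thesis
      by (auto simp: zero_enat_def[symmetric])
  next
    case infinity
    define t where "t = (\<lambda>j. (1/2)^j * min 1 (dj j F G))"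
    have nn: "0 \<le> t j" for j using dj_nonneg[OF FG, of j] by (simp add: t_def infinity)
    have "summable t"
    proof (rule summable_comparison_test_ev[OF _ summable_geometric[of "1/2::real"]])
      show "\<forall>\<^sub>F n in sequentially. norm (t n) \<le> (1/2)^n"
        using dj_nonneg[OF FG] infinity
        by (intro always_eventually allI) (simp add: t_def abs_mult abs_of_nonneg mult_left_le)
    qed simp
    have d: "dr r F G = suminf t" by (simp add: dr_def infinity t_def)
    have "t j \<le> dr r F G" for j
      using sum_le_suminf[OF \<open>summable t\<close>, of "{j}"] nn by (simp add: d)
    from this[of 0] this[of 1] nn[of 0] show ?thesis by (auto simp: t_def min_def split: if_splits)
  qed
  then show "0 \<le> dr r F G"
    and "\<epsilon> \<le> 1/4 \<Longrightarrow> dr r F G < \<epsilon> / 2 \<Longrightarrow> dj 0 F G < \<epsilon> \<and> dj 1 F G < \<epsilon>" by blast+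
qed

text \<open>Closeness on the circle gives an integer near F - G at each point. It cannot change: by
  continuity F - G would then take a half-integer value, too far from every integer.\<close>

lemma near_of_dr:
  assumes FG: "circ_diff r F" "circ_diff r G" and r: "1 \<le> r"
    and \<epsilon>: "\<epsilon> \<le> 1/4" and d: "dr r F G < \<epsilon> / 2"
  shows "\<exists>n::int. near \<epsilon> F (\<lambda>x. G x + of_int n)"
proof -
  have dj: "dj 0 F G < \<epsilon>" "dj 1 F G < \<epsilon>" using dr_bounds(2)[OF FG r \<epsilon> d] by blast+
  define D where "D = (\<lambda>x. F x - G x)"
  have "\<exists>n::int. \<bar>D x - of_int n\<bar> < \<epsilon>" for x
    using cdist_le_dj0[of F x G] dj(1) cdist_less_iff[of "F x" "G x" \<epsilon>] by (simp add: D_def)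
  then obtain N :: "real \<Rightarrow> int" where N: "\<And>x. \<bar>D x - of_int (N x)\<bar> < \<epsilon>" by metis
  have cont: "continuous_on UNIV D"
    using circ_diff_hlift[OF FG(1)] circ_diff_hlift[OF FG(2)]
    unfolding D_def hlift_def by (intro continuous_intros) auto
  have "connected (range D)" by (intro connected_continuous_image cont connected_UNIV)
  then have between: "\<exists>z. D z = v" if "D x \<le> v" "v \<le> D y" for x y v
    using connectedD_interval[of "range D" "D x" "D y" v] that by auto
  have N0: "N x = N 0" for x
  proof (rule ccontr)
    assume "N x \<noteq> N 0"
    have half: "\<not> \<bar>v - of_int (N z)\<bar> < 1/4" if "v = of_int m + 1/2" for v z :: real and m :: int
    proof
      assume "\<bar>v - of_int (N z)\<bar> < 1/4"
      then have "real_of_int (m - N z) < 0" "real_of_int (m - N z) > -1"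
        using that unfolding of_int_diff by linarith+
      then have "m - N z < 0" "m - N z > -1" by linarith+
      then show False by linarith
    qed
    consider "N x \<ge> N 0 + 1" | "N 0 \<ge> N x + 1" using \<open>N x \<noteq> N 0\<close> by linarith
    then have "\<exists>z. \<exists>m::int. D z = of_int m + 1/2"
    proof cases
      case 1
      then have "real_of_int (N x) \<ge> of_int (N 0) + 1" by linarith
      then have "D 0 \<le> of_int (N 0) + 1/2" "of_int (N 0) + 1/2 \<le> D x"
        using N[of 0] N[of x] \<epsilon> by linarith+
      then show ?thesis using between by blast
    next
      case 2
      then have "real_of_int (N 0) \<ge> of_int (N x) + 1" by linarith
      then have "D x \<le> of_int (N x) + 1/2" "of_int (N x) + 1/2 \<le> D 0"
        using N[of 0] N[of x] \<epsilon> by linarith+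
      then show ?thesis using between by blast
    qed
    then obtain z and m :: int where "D z = of_int m + 1/2" by blast
    with half[of "D z" m z] N[of z] \<epsilon> show False by linarith
  qed
  have diff: "(F has_real_derivative deriv F x) (at x)" if "circ_diff r F" for F x
  proof -
    have "((deriv ^^ 0) F) differentiable (at x)"
      using that r unfolding circ_diff_def Ck_def by (metis enat_0 i0_less not_one_le_zero)
    then show ?thesis
      by (simp add: DERIV_deriv_iff_real_differentiable)
  qed
  have "\<bar>(G x + of_int (N 0) - F x) - (G y + of_int (N 0) - F y)\<bar> \<le> \<epsilon> * \<bar>x - y\<bar>" for x y
  proof -
    \<comment> \<open>The mean value inequality turns the bound on the derivatives into the
      Lipschitz bound of \<open>near\<close>.\<close>
    have "norm ((G x - F x) - (G y - F y)) \<le> \<epsilon> * norm (x - y)"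
    proof (rule field_differentiable_bound[of UNIV "\<lambda>x. G x - F x" "\<lambda>x. deriv G x - deriv F x"])
      fix z
      show "((\<lambda>x. G x - F x) has_real_derivative deriv G z - deriv F z) (at z within UNIV)"
        by (intro DERIV_diff diff FG)
      show "norm (deriv G z - deriv F z) \<le> \<epsilon>"
        using deriv_le_dj1[OF FG r, of z] dj(2) by auto
    qed auto
    moreover have "(G x + of_int (N 0) - F x) - (G y + of_int (N 0) - F y) = (G x - F x) - (G y - F y)" by simp
    ultimately show ?thesis by simp
  qed
  moreover have "\<bar>G x + of_int (N 0) - F x\<bar> \<le> \<epsilon>" for x
    using N[of x] unfolding N0[of x] by (simp add: D_def)
  ultimately show ?thesis unfolding near_def by blast
qed

text \<open>Relabelling letters and changing lifts by integers alters each composition by an integer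
  only.\<close>

lemma trans_ifs_transfer:
  assumes G: "hlifts k G" and H: "trans_ifs k H"
    and \<sigma>: "\<And>i. i \<in> {1..k} \<Longrightarrow> \<sigma> i \<in> {1..k} \<and> (\<forall>x. H i x = G (\<sigma> i) x + of_int (n i :: int))"
  shows "trans_ifs k G"
proof -
  have fold: "\<exists>m::int. fold H w x = fold G (map \<sigma> w) x + of_int m" if "set w \<subseteq> {1..k}" for w x
    using that
  proof (induction w arbitrary: x)
    case (Cons i w)
    then obtain m :: int where m: "fold H w (H i x) = fold G (map \<sigma> w) (H i x) + of_int m" by auto
    have "set (map \<sigma> w) \<subseteq> {1..k}" using Cons.prems \<sigma> by auto
    from hlift_translate[OF hlift_fold[OF G this]]
    have "fold G (map \<sigma> w) (H i x) = fold G (map \<sigma> w) (G (\<sigma> i) x) + of_int (n i)"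
      using Cons.prems \<sigma> by auto
    with m show ?case by (intro exI[of _ "m + n i"]) simp
  qed (auto intro: exI[of _ 0])
  show ?thesis unfolding trans_ifs_def
  proof (intro allI impI)
    fix a b c d :: real assume "a < b" "c < d"
    then obtain w x and l :: int where w: "set w \<subseteq> {1..k}" "a < x" "x < b"
      "c < fold H w x + of_int l" "fold H w x + of_int l < d"
      using H unfolding trans_ifs_def by meson
    obtain m :: int where m: "fold H w x = fold G (map \<sigma> w) x + of_int m" using fold w by blast
    have "set (map \<sigma> w) \<subseteq> {1..k}" using w \<sigma> by auto
    with w m show "\<exists>w x. \<exists>n::int. set w \<subseteq> {1..k} \<and> a < x \<and> x < b \<and>
        c < fold G w x + of_int n \<and> fold G w x + of_int n < d"
      by (intro exI[of _ "map \<sigma> w"] exI[of _ x] exI[of _ "m + l"]) (simp add: add.assoc)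
  qed
qed

text \<open>The minimum over permutations is attained and its summands are nonnegative, so after
  relabelling and a choice of lifts every map is \<open>near\<close> its model.\<close>

lemma SRT_I:
  assumes \<nu>: "0 < \<nu>" "\<nu> < 1" and k: "k \<ge> 1" and r: "1 \<le> r" and F: "IFS r k F" and \<epsilon>: "0 < \<epsilon>"
    and robust: "\<And>H. hlifts k H \<Longrightarrow> (\<And>i. i \<in> {1..k} \<Longrightarrow> near \<epsilon> (F i) (H i)) \<Longrightarrow> trans_ifs k H"
  shows "SRT r k \<nu> F"
  unfolding SRT_def
proof (intro conjI F exI[of _ "min \<epsilon> (1/4) / 2"] allI impI)
  define e where "e = min \<epsilon> (1/4)"
  show "0 < min \<epsilon> (1/4) / 2" using \<epsilon> by simp
  fix G assume "IFS r k G \<and> dbar r k F G < min \<epsilon> (1/4) / 2"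
  then have G: "\<And>i. i \<in> {1..k} \<Longrightarrow> circ_diff r (G i)" and d: "dbar r k F G < e / 2"
    by (auto simp: IFS_def e_def)
  have Fi: "\<And>i. i \<in> {1..k} \<Longrightarrow> circ_diff r (F i)" using F by (auto simp: IFS_def)
  have hG: "hlifts k G" unfolding hlifts_def using G circ_diff_hlift by blast
  let ?S = "{(\<Sum>i\<in>{1..k}. dr r (F i) (G (\<sigma> i))) | \<sigma>. \<sigma> permutes {1..k}}"
  have "?S = (\<lambda>\<sigma>. \<Sum>i\<in>{1..k}. dr r (F i) (G (\<sigma> i))) ` {\<sigma>. \<sigma> permutes {1..k}}" by auto
  then have "finite ?S" using finite_permutations[of "{1..k}"] by simp
  moreover have "?S \<noteq> {}" using permutes_id[of "{1..k}"] by blast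
  ultimately have "Min ?S \<in> ?S" by (rule Min_in)
  then obtain \<sigma> where \<sigma>: "\<sigma> permutes {1..k}" "(\<Sum>i\<in>{1..k}. dr r (F i) (G (\<sigma> i))) < e / 2"
    using d unfolding dbar_def by auto
  have \<sigma>i: "\<sigma> i \<in> {1..k}" if "i \<in> {1..k}" for i using permutes_in_image[OF \<sigma>(1)] that by blast
  have "\<exists>n::int. near e (F i) (\<lambda>x. G (\<sigma> i) x + of_int n)" if i: "i \<in> {1..k}" for i
  proof (rule near_of_dr[OF Fi[OF i] G[OF \<sigma>i[OF i]] r])
    have "dr r (F i) (G (\<sigma> i)) \<le> (\<Sum>i\<in>{1..k}. dr r (F i) (G (\<sigma> i)))"
      using i by (intro member_le_sum dr_bounds(1) Fi G \<sigma>i r) auto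
    then show "dr r (F i) (G (\<sigma> i)) < e / 2" using \<sigma>(2) by simp
  qed (simp add: e_def)
  then obtain n :: "nat \<Rightarrow> int" where n: "\<And>i. i \<in> {1..k} \<Longrightarrow> near e (F i) (\<lambda>x. G (\<sigma> i) x + of_int (n i))"
    by metis
  define H where "H = (\<lambda>i x. G (\<sigma> i) x + of_int (n i))"
  have "trans_ifs k H"
  proof (rule robust)
    show "hlifts k H"
      using hG \<sigma>i unfolding hlifts_def hlift_def H_def
      by (auto simp: strict_mono_def intro!: continuous_intros)
    show "near \<epsilon> (F i) (H i)" if "i \<in> {1..k}" for i
    proof -
      have "e * \<bar>x - y\<bar> \<le> \<epsilon> * \<bar>x - y\<bar>" for x y :: real by (intro mult_right_mono) (auto simp: e_def)
      moreover have "e \<le> \<epsilon>" by (simp add: e_def)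
      ultimately show ?thesis using n[OF that] unfolding near_def H_def by (meson order_trans)
    qed
  qed
  then have "trans_ifs k G"
    by (rule trans_ifs_transfer[OF hG, of H \<sigma> n]) (use \<sigma>i in \<open>auto simp: H_def\<close>)
  then show "has_dense_orbit k \<nu> G" using has_dense_orbitI[OF hG _ \<nu> k] by blast
qed

section \<open>A criterion for robust transitivity\<close>

lemma near_bound: "near \<epsilon> F H \<Longrightarrow> \<bar>H x - F x\<bar> \<le> \<epsilon>"
  by (simp add: near_def)

lemma near_slope:
  assumes "near \<epsilon> F H" "F x - F y = s * (x - y)"
  shows "\<bar>(H x - H y) - s * (x - y)\<bar> \<le> \<epsilon> * \<bar>x - y\<bar>"
proof -
  have "\<bar>(H x - F x) - (H y - F y)\<bar> \<le> \<epsilon> * \<bar>x - y\<bar>" using assms(1) by (simp add: near_def)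
  moreover have "(H x - F x) - (H y - F y) = (H x - H y) - s * (x - y)" using assms(2) by simp
  ultimately show ?thesis by simp
qed

lemma near_IVT:
  assumes "hlift H" "near \<epsilon> F H" "u \<le> v" "F u + \<epsilon> \<le> y" "y \<le> F v - \<epsilon>"
  shows "\<exists>x\<in>{u..v}. H x = y"
proof -
  have "H u \<le> y" "y \<le> H v"
    using near_bound[OF assms(2), of u] near_bound[OF assms(2), of v] assms(4,5) by linarith+
  moreover have "continuous_on {u..v} H"
    using assms(1) by (auto simp: hlift_def intro: continuous_on_subset)
  ultimately show ?thesis using IVT'[of H u y v] assms(3) by auto
qed

text \<open>After finitely many doublings the length exceeds 1, where only the first alternative
  remains.\<close>

lemma growth_induct:
  fixes P :: "real \<Rightarrow> real \<Rightarrow> bool"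
  assumes step: "\<And>a b. a < b \<Longrightarrow>
      P a b \<or> (b - a \<le> 1 \<and> (\<exists>a' b'. 2 * (b - a) \<le> b' - a' \<and> (P a' b' \<longrightarrow> P a b)))"
    and "a < b"
  shows "P a b"
proof -
  have "P a b" if "a < b" "1 < 2 ^ n * (b - a)" for n a b
    using that
  proof (induction n arbitrary: a b)
    case 0
    then show ?case using step[of a b] by auto
  next
    case (Suc n)
    show ?case
    proof (cases "P a b")
      case False
      then obtain a' b' where *: "2 * (b - a) \<le> b' - a'" "P a' b' \<longrightarrow> P a b"
        using step[OF Suc.prems(1)] by blast
      have "2 ^ n * (2 * (b - a)) \<le> 2 ^ n * (b' - a')" using *(1) by (intro mult_left_mono) auto
      then show ?thesis using Suc *(1) * by (auto simp: algebra_simps)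
    qed
  qed
  moreover obtain n where "1 / (b - a) < 2 ^ n" using real_arch_pow[of 2 "1 / (b - a)"] by auto
  ultimately show ?thesis using \<open>a < b\<close> by (auto simp: field_simps)
qed

text \<open>The midpoint lies between two consecutive translates of [q0, q1]; an end of either
  inside (a, b) would contradict \<open>no\<close>.\<close>

lemma interval_in_gap:
  fixes q0 q1 p a b :: real
  assumes "q0 \<le> q1" "0 < p" "a < b"
    and no: "\<And>y M. a < y \<Longrightarrow> y < b \<Longrightarrow> q0 + of_int M * p \<le> y \<Longrightarrow> y \<le> q1 + of_int M * p \<Longrightarrow> False"
  obtains M :: int where "q1 - p + of_int M * p \<le> a" "b \<le> q0 + of_int M * p"
proof
  define x where "x = (a + b) / 2"
  define M where "M = \<lfloor>(x - q0) / p\<rfloor> + 1"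
  have x: "a < x" "x < b" using \<open>a < b\<close> by (auto simp: x_def)
  have "of_int (M - 1) \<le> (x - q0) / p" "(x - q0) / p < of_int M" by (auto simp: M_def)
  then have M: "q0 + of_int (M - 1) * p \<le> x" "x < q0 + of_int M * p"
    using \<open>0 < p\<close> by (auto simp: field_simps)
  have "q1 + of_int (M - 1) * p < x" using no[OF x M(1)] not_le by blast
  then have "q1 + of_int (M - 1) * p \<le> a"
    using no[of "q1 + of_int (M - 1) * p" "M - 1"] x \<open>q0 \<le> q1\<close> by force
  then show "q1 - p + of_int M * p \<le> a" by (simp add: algebra_simps)
  show "b \<le> q0 + of_int M * p"
    using no[of "q0 + of_int M * p" M] M x \<open>q0 \<le> q1\<close> by (intro leI notI) auto
qed

text \<open>The perturbed map contracts the chart [u, v] by at least 1/2, so its inverse at least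
  doubles lengths; the margins \<epsilon> keep [a, b] inside the perturbed image.\<close>

lemma back_chart:
  assumes H: "hlift H" "near \<epsilon> F H" and F: "\<And>x y. x \<in> {u..v} \<Longrightarrow> y \<in> {u..v} \<Longrightarrow> F x - F y = s * (x - y)"
    and s: "0 \<le> s" "s + \<epsilon> \<le> 1/2" and "u \<le> v" "F u + \<epsilon> \<le> a" "a < b" "b \<le> F v - \<epsilon>"
  obtains a' b' where "2 * (b - a) \<le> b' - a'" "\<And>x. a' < x \<Longrightarrow> x < b' \<Longrightarrow> a < H x \<and> H x < b"
proof -
  obtain a' where a': "a' \<in> {u..v}" "H a' = a" using near_IVT[OF H, of u v a] assms(6-9) by force
  obtain b' where b': "b' \<in> {u..v}" "H b' = b" using near_IVT[OF H, of u v b] assms(6-9) by force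
  have "a' < b'" using hlift_less_iff[OF H(1), of a' b'] a' b' \<open>a < b\<close> by simp
  have "\<bar>(H b' - H a') - s * (b' - a')\<bar> \<le> \<epsilon> * \<bar>b' - a'\<bar>"
    using near_slope[OF H(2) F[OF b'(1) a'(1)]] .
  then have "b - a \<le> (s + \<epsilon>) * (b' - a')" using a' b' \<open>a' < b'\<close> by (auto simp: algebra_simps)
  also have "\<dots> \<le> 1/2 * (b' - a')" using s \<open>a' < b'\<close> by (intro mult_right_mono) auto
  finally show ?thesis using that[of b' a'] hlift_less_iff[OF H(1)] a' b' by auto
qed

text \<open>The word is chosen from its last letter backwards: y is the image of some point of J,
  which becomes the new target. Every letter then shrinks the error by \<open>lam\<close>.\<close>

lemma blender_words:
  fixes H :: "nat \<Rightarrow> real \<Rightarrow> real"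
  assumes inv: "\<And>i x. i \<in> I \<Longrightarrow> x \<in> {l0..l1} \<Longrightarrow> H i x \<in> {l0..l1}"
    and con: "\<And>i x y. i \<in> I \<Longrightarrow> x \<in> {l0..l1} \<Longrightarrow> y \<in> {l0..l1} \<Longrightarrow> \<bar>H i x - H i y\<bar> \<le> lam * \<bar>x - y\<bar>"
    and cov: "\<And>y. y \<in> J \<Longrightarrow> \<exists>i\<in>I. \<exists>z\<in>J. H i z = y"
    and J: "J \<subseteq> {l0..l1}" and lam: "0 \<le> lam" and "y \<in> J"
  shows "\<exists>w. length w = n \<and> set w \<subseteq> I \<and>
    (\<forall>x\<in>{l0..l1}. fold H w x \<in> {l0..l1} \<and> \<bar>fold H w x - y\<bar> \<le> lam ^ n * (l1 - l0))"
  using \<open>y \<in> J\<close>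
proof (induction n arbitrary: y)
  case 0
  then have "y \<in> {l0..l1}" using J by blast
  then show ?case by (intro exI[of _ "[]"]) auto
next
  case (Suc n)
  obtain i z where i: "i \<in> I" "z \<in> J" "H i z = y" using cov[OF Suc.prems] by blast
  obtain w where w: "length w = n" "set w \<subseteq> I"
    "\<And>x. x \<in> {l0..l1} \<Longrightarrow> fold H w x \<in> {l0..l1} \<and> \<bar>fold H w x - z\<bar> \<le> lam ^ n * (l1 - l0)"
    using Suc.IH[OF i(2)] by blast
  show ?case
  proof (intro exI[of _ "w @ [i]"] conjI ballI)
    fix x assume x: "x \<in> {l0..l1}"
    have "\<bar>H i (fold H w x) - H i z\<bar> \<le> lam * \<bar>fold H w x - z\<bar>"
      using con[OF i(1)] w(3)[OF x] i(2) J by blast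
    also have "\<dots> \<le> lam * (lam ^ n * (l1 - l0))" using w(3)[OF x] lam by (intro mult_left_mono) auto
    finally show "\<bar>fold H (w @ [i]) x - y\<bar> \<le> lam ^ Suc n * (l1 - l0)" using i(3) by (simp add: mult.assoc)
    show "fold H (w @ [i]) x \<in> {l0..l1}" using inv[OF i(1)] w(3)[OF x] by simp
  qed (use w i in auto)
qed

text \<open>By continuity w sends a neighbourhood of z into the target, and blender words squeeze
  all of [l0, l1] into that neighbourhood. Their length is free beyond a threshold, so every large
  exact length occurs.\<close>

lemma blender_reach:
  fixes H :: "nat \<Rightarrow> real \<Rightarrow> real"
  assumes H: "hlifts k H" and I: "I \<subseteq> {1..k}"
    and inv: "\<And>i x. i \<in> I \<Longrightarrow> x \<in> {l0..l1} \<Longrightarrow> H i x \<in> {l0..l1}"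
    and con: "\<And>i x y. i \<in> I \<Longrightarrow> x \<in> {l0..l1} \<Longrightarrow> y \<in> {l0..l1} \<Longrightarrow> \<bar>H i x - H i y\<bar> \<le> lam * \<bar>x - y\<bar>"
    and cov: "\<And>y. y \<in> J \<Longrightarrow> \<exists>i\<in>I. \<exists>z\<in>J. H i z = y"
    and J: "J \<subseteq> {l0..l1}" and lam: "0 \<le> lam" "lam < 1"
    and hit: "\<exists>w z. \<exists>n::int. set w \<subseteq> {1..k} \<and> z \<in> J \<and> c < fold H w z + of_int n \<and> fold H w z + of_int n < d"
  shows "\<exists>N. \<forall>n\<ge>N. \<exists>w. \<exists>m::int. length w = n \<and> set w \<subseteq> {1..k} \<and>
    (\<forall>x\<in>{l0..l1}. c < fold H w x + of_int m \<and> fold H w x + of_int m < d)"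
proof -
  obtain w z and m :: int where w: "set w \<subseteq> {1..k}" "z \<in> J"
    "c < fold H w z + of_int m" "fold H w z + of_int m < d" using hit by blast
  define S where "S = {x. c < fold H w x + of_int m \<and> fold H w x + of_int m < d}"
  have "open S"
    using hlift_fold[OF H w(1)] unfolding hlift_def S_def
    by (intro open_Collect_conj open_Collect_less continuous_intros) auto
  then obtain e where e: "0 < e" "\<And>x. \<bar>x - z\<bar> < e \<Longrightarrow> x \<in> S"
    using w unfolding open_dist dist_real_def S_def by blast
  have "(\<lambda>n. lam ^ n * (l1 - l0)) \<longlonglongrightarrow> 0 * (l1 - l0)"
    using lam by (intro tendsto_mult LIMSEQ_realpow_zero tendsto_const)
  then have "\<forall>\<^sub>F n in sequentially. lam ^ n * (l1 - l0) < e"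
    using order_tendstoD(2) e(1) by fastforce
  then obtain n1 where n1: "\<And>n. n \<ge> n1 \<Longrightarrow> lam ^ n * (l1 - l0) < e"
    by (auto simp: eventually_sequentially)
  show ?thesis
  proof (intro exI[of _ "n1 + length w"] allI impI)
    fix n assume n: "n \<ge> n1 + length w"
    obtain v where v: "length v = n - length w" "set v \<subseteq> I"
      "\<And>x. x \<in> {l0..l1} \<Longrightarrow> \<bar>fold H v x - z\<bar> \<le> lam ^ (n - length w) * (l1 - l0)"
      using blender_words[where H=H and I=I and J=J and lam=lam and n="n - length w",
          OF inv con cov J lam(1) w(2)] by blast
    have "fold H v x \<in> S" if "x \<in> {l0..l1}" for x
      using v(3)[OF that] n1[of "n - length w"] n by (intro e(2)) linarith
    then show "\<exists>w. \<exists>m::int. length w = n \<and> set w \<subseteq> {1..k} \<and>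
        (\<forall>x\<in>{l0..l1}. c < fold H w x + of_int m \<and> fold H w x + of_int m < d)"
      using v n w I by (intro exI[of _ "v @ w"] exI[of _ m]) (auto simp: S_def)
  qed
qed

text \<open>J lies between the fixed points 3t and 3t' of the two contractions: map p covers J up to
  c and map q the remainder. The rate is 2/3 + 1/12 = 3/4.\<close>

lemma affine_blender:
  assumes H: "hlift (H p)" "hlift (H q)" "near \<epsilon> (F p) (H p)" "near \<epsilon> (F q) (H q)"
    and F: "\<And>x. x \<in> {l0..l1} \<Longrightarrow> F p x = 2/3 * x + t" "\<And>x. x \<in> {l0..l1} \<Longrightarrow> F q x = 2/3 * x + t'"
    and L: "l0 + \<epsilon> \<le> 2/3 * l0 + t" "2/3 * l1 + t + \<epsilon> \<le> l1" "l0 + \<epsilon> \<le> 2/3 * l0 + t'" "2/3 * l1 + t' + \<epsilon> \<le> l1"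
    and J: "l0 \<le> j0" "j0 \<le> j1" "j1 \<le> l1" "2/3 * j0 + t + \<epsilon> \<le> j0" "c \<le> 2/3 * j1 + t - \<epsilon>"
      "2/3 * j0 + t' + \<epsilon> \<le> c" "j1 \<le> 2/3 * j1 + t' - \<epsilon>"
    and \<epsilon>: "\<epsilon> \<le> 1/12"
  shows "i \<in> {p, q} \<Longrightarrow> x \<in> {l0..l1} \<Longrightarrow> H i x \<in> {l0..l1}"
    and "i \<in> {p, q} \<Longrightarrow> x \<in> {l0..l1} \<Longrightarrow> y \<in> {l0..l1} \<Longrightarrow> \<bar>H i x - H i y\<bar> \<le> 3/4 * \<bar>x - y\<bar>"
    and "y \<in> {j0..j1} \<Longrightarrow> \<exists>i\<in>{p, q}. \<exists>z\<in>{j0..j1}. H i z = y"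
proof -
  show "H i x \<in> {l0..l1}" if "i \<in> {p, q}" "x \<in> {l0..l1}"
    using that F(1)[of x] F(2)[of x] near_bound[OF H(3), of x] near_bound[OF H(4), of x] L by auto
  show "\<bar>H i x - H i y\<bar> \<le> 3/4 * \<bar>x - y\<bar>" if i: "i \<in> {p, q}" and xy: "x \<in> {l0..l1}" "y \<in> {l0..l1}"
  proof -
    have "near \<epsilon> (F i) (H i)" "F i x - F i y = 2/3 * (x - y)" using i F xy H by (auto simp: algebra_simps)
    from near_slope[OF this] have "\<bar>H i x - H i y\<bar> \<le> \<bar>2/3 * (x - y)\<bar> + \<epsilon> * \<bar>x - y\<bar>" by linarith
    then have "\<bar>H i x - H i y\<bar> \<le> 2/3 * \<bar>x - y\<bar> + \<epsilon> * \<bar>x - y\<bar>" unfolding abs_mult by simp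
    also have "\<dots> \<le> 2/3 * \<bar>x - y\<bar> + 1/12 * \<bar>x - y\<bar>" using \<epsilon> by (intro add_left_mono mult_right_mono) auto
    finally show ?thesis by simp
  qed
  show "\<exists>i\<in>{p, q}. \<exists>z\<in>{j0..j1}. H i z = y" if "y \<in> {j0..j1}"
    using near_IVT[OF H(1,3) J(2), of y] near_IVT[OF H(2,4) J(2), of y] that F[of j0] F[of j1] J
    by (cases "y \<le> c") auto
qed

section \<open>A robustly transitive family with a common fixed point\<close>

text \<open>Letters 1 and 2 contract towards 1/3 and 2/3 and form the blender. Near the common fixed
  point 0, letter 3 expands by 4 and letter 4 contracts by 4.\<close>

definition Psi :: "nat \<Rightarrow> real \<Rightarrow> real" where
  "Psi i = (if i = 1 then W_map else if i = 2 then (\<lambda>x. 1 - W_map (1 - x))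
     else if i = 3 then (\<lambda>x. T_map (x - 1/2) + 1/2) else T_map)"

lemma circ_diff_mirror: "lift_diffeo F \<Longrightarrow> circ_diff r (\<lambda>x. b - F (a - x))"
  using lift_diffeo_circ_diff[OF lift_diffeo_affine_conj[of F "-1" a b]] by simp

lemma circ_diff_rotate: "lift_diffeo F \<Longrightarrow> circ_diff r (\<lambda>x. F (x + a) + b)"
  using lift_diffeo_circ_diff[OF lift_diffeo_affine_conj[of F 1 a b]] by simp

lemma IFS_Psi: "IFS r k Psi"
proof -
  have "circ_diff r (Psi i)" for i
    using circ_diff_mirror[OF W_map_lift_diffeo, of r 1 1] circ_diff_rotate[OF T_map_lift_diffeo, of r "-1/2" "1/2"]
      lift_diffeo_circ_diff W_map_lift_diffeo T_map_lift_diffeo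
    by (auto simp: Psi_def)
  then show ?thesis by (simp add: IFS_def)
qed

lemma Psi_0: "Psi i 0 = 0"
proof -
  have "W_map 1 = 1" using W_map_translate[of 0] W_map_0 by simp
  moreover have "T_map (-1/2) = -1/2"
    using T_map_translate[of "-1/2"] T_map_expand[of "1/2"] by simp
  ultimately show ?thesis by (simp add: Psi_def W_map_0 T_map_contract)
qed

lemma Psi_values:
  "x \<in> {1/5..4/5} \<Longrightarrow> Psi 1 x = 2/3 * x + 1/9"
  "x \<in> {1/5..4/5} \<Longrightarrow> Psi 2 x = 2/3 * x + 2/9"
  "\<bar>x\<bar> \<le> 99/1000 \<Longrightarrow> Psi 3 x = 4 * x"
  "\<bar>x\<bar> \<le> 399/1000 \<Longrightarrow> Psi 4 x = x / 4"
proof -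
  show "\<bar>x\<bar> \<le> 99/1000 \<Longrightarrow> Psi 3 x = 4 * x"
    using T_map_translate[of "x - 1/2"] T_map_expand[of "x + 1/2"] by (simp add: Psi_def abs_le_iff add.commute)
  show "x \<in> {1/5..4/5} \<Longrightarrow> Psi 2 x = 2/3 * x + 2/9"
    using W_map_contract[of "1 - x"] by (simp add: Psi_def field_simps)
qed (simp_all add: Psi_def W_map_contract T_map_contract)

text \<open>Arcs near 0 are enlarged by letter 3 forwards and by the inverse of letter 4 backwards.
  Away from 0, letter 3 leads into L and letter 4 leads out of J in one step; the blender joins the
  two.\<close>

lemma Psi_robust:
  assumes k: "k \<ge> 4" and H: "hlifts k H" and nr: "\<And>i. i \<in> {1..k} \<Longrightarrow> near (1/1000) (Psi i) (H i)"
  shows "trans_ifs k H"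
proof -
  have hl: "hlift (H i)" if "i \<in> {1..4}" for i using H that k by (auto simp: hlifts_def)
  have ner: "near (1/1000) (Psi i) (H i)" if "i \<in> {1..4}" for i using nr that k by auto
  define L where "L = {1/5..4/5::real}"
  define J where "J = {7/20..13/20::real}"
  have backw: "\<exists>w z. \<exists>n::int. set w \<subseteq> {1..k} \<and> z \<in> J \<and> a < fold H w z + of_int n \<and> fold H w z + of_int n < b"
    if "a < b" for a b
  proof (rule growth_induct[OF _ that])
    fix a b :: real assume "a < b"
    let ?P = "\<lambda>a b. \<exists>w z. \<exists>n::int. set w \<subseteq> {1..k} \<and> z \<in> J \<and>
        a < fold H w z + of_int n \<and> fold H w z + of_int n < b"
    show "?P a b \<or> (b - a \<le> 1 \<and> (\<exists>a' b'. 2 * (b - a) \<le> b' - a' \<and> (?P a' b' \<longrightarrow> ?P a b)))"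
    proof (rule disjCI)
      assume nope: "\<not> (b - a \<le> 1 \<and> (\<exists>a' b'. 2 * (b - a) \<le> b' - a' \<and> (?P a' b' \<longrightarrow> ?P a b)))"
      show "?P a b"
      proof (rule ccontr)
        assume np: "\<not> ?P a b"
        \<comment> \<open>J crosses the expanding part of letter 4, so its image [7/80, 73/80]
          covers [1/11, 10/11] with room for the perturbation. The remaining gap around 0 lies in
          the image of the contracting part, which reaches to 399/4000 on both sides.\<close>
        have "False" if "a < y" "y < b" "1/11 + of_int M * 1 \<le> y" "y \<le> 10/11 + of_int M * 1" for y :: real and M
        proof -
          have "Psi 4 (13/20) = Psi 4 (-7/20) + 1"
            using T_map_translate[of "-7/20"] by (simp add: Psi_def)
          then have "\<exists>z\<in>{7/20..13/20}. H 4 z = y - of_int M"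
            using that by (intro near_IVT[OF hl ner]) (auto simp: Psi_values)
          then obtain z where "z \<in> J" "H 4 z = y - of_int M" by (auto simp: J_def)
          then have "?P a b" using that k
            by (intro exI[of _ "[4]"] exI[of _ z] exI[of _ M]) auto
          with np show False by blast
        qed
        then obtain M :: int where M: "-1/11 + of_int M \<le> a" "b \<le> 1/11 + of_int M"
          using interval_in_gap[of "1/11" "10/11" 1 a b] \<open>a < b\<close> by auto
        obtain a' b' where ab: "2 * ((b - of_int M) - (a - of_int M)) \<le> b' - a'"
          "\<And>x. a' < x \<Longrightarrow> x < b' \<Longrightarrow> a - of_int M < H 4 x \<and> H 4 x < b - of_int M"
          by (rule back_chart[of "H 4" "1/1000" "Psi 4" "-399/1000" "399/1000" "1/4" "a - of_int M" "b - of_int M"])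
            (use M \<open>a < b\<close> in \<open>auto simp: Psi_values hl ner algebra_simps\<close>)
        have "?P a b" if *: "?P a' b'"
        proof -
          obtain w z and n :: int where w: "set w \<subseteq> {1..k}" "z \<in> J" "a' < fold H w z + of_int n" "fold H w z + of_int n < b'"
            using * by blast
          have "H 4 (fold H w z + of_int n) = H 4 (fold H w z) + of_int n" using hlift_translate hl by simp
          then show ?thesis using ab(2)[OF w(3,4)] w k
            by (intro exI[of _ "w @ [4]"] exI[of _ z] exI[of _ "n + M"]) auto
        qed
        with nope ab(1) M show False by auto
      qed
    qed
  qed
  have forw: "\<exists>w x. \<exists>n::int. set w \<subseteq> {1..k} \<and> a < x \<and> x < b \<and> fold H w x + of_int n \<in> L"
    if "a < b" for a b
  proof (rule growth_induct[OF _ that])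
    fix a b :: real assume "a < b"
    let ?P = "\<lambda>a b. \<exists>w x. \<exists>n::int. set w \<subseteq> {1..k} \<and> a < x \<and> x < b \<and> fold H w x + of_int n \<in> L"
    show "?P a b \<or> (b - a \<le> 1 \<and> (\<exists>a' b'. 2 * (b - a) \<le> b' - a' \<and> (?P a' b' \<longrightarrow> ?P a b)))"
    proof (rule disjCI)
      assume nope: "\<not> (b - a \<le> 1 \<and> (\<exists>a' b'. 2 * (b - a) \<le> b' - a' \<and> (?P a' b' \<longrightarrow> ?P a b)))"
      show "?P a b"
      proof (rule ccontr)
        assume np: "\<not> ?P a b"
        \<comment> \<open>Letter 3 maps [1/11, 10/11] onto [4/11, 7/11], well inside L.\<close>
        have "False" if "a < y" "y < b" "1/11 + of_int M * 1 \<le> y" "y \<le> 10/11 + of_int M * 1" for y :: real and M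
        proof -
          have "Psi 3 (10/11) = Psi 3 (-1/11) + 1"
            using T_map_translate[of "-1/11 - 1/2"] by (simp add: Psi_def)
          moreover have "H 3 (1/11) \<le> H 3 (y - of_int M)" "H 3 (y - of_int M) \<le> H 3 (10/11)"
            using that by (auto simp: hlift_le_iff hl)
          moreover have "Psi 3 (1/11) = 4/11" "Psi 3 (-1/11) = -4/11" by (simp_all add: Psi_values)
          moreover have "\<bar>H 3 (1/11) - Psi 3 (1/11)\<bar> \<le> 1/1000" "\<bar>H 3 (10/11) - Psi 3 (10/11)\<bar> \<le> 1/1000"
            by (rule near_bound; simp add: ner)+
          ultimately have "1/5 \<le> H 3 (y - of_int M)" "H 3 (y - of_int M) \<le> 4/5" by linarith+
          then have "H 3 (y - of_int M) \<in> L" by (simp add: L_def)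
          moreover have "H 3 (y + of_int (- M)) = H 3 y + of_int (- M)" by (rule hlift_translate) (simp add: hl)
          ultimately have "?P a b" using that k
            by (intro exI[of _ "[3]"] exI[of _ y] exI[of _ "- M"]) auto
          with np show False by blast
        qed
        then obtain M :: int where M: "-1/11 + of_int M \<le> a" "b \<le> 1/11 + of_int M"
          using interval_in_gap[of "1/11" "10/11" 1 a b] \<open>a < b\<close> by auto
        define a0 where "a0 = a - of_int M"
        define b0 where "b0 = b - of_int M"
        have ab0: "-1/11 \<le> a0" "a0 < b0" "b0 \<le> 1/11" using M \<open>a < b\<close> by (auto simp: a0_def b0_def)
        have "\<bar>(H 3 b0 - H 3 a0) - 4 * (b0 - a0)\<bar> \<le> 1/1000 * \<bar>b0 - a0\<bar>"
          by (rule near_slope[of _ "Psi 3"]) (use ab0 in \<open>auto simp: Psi_values ner\<close>)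
        then have "2 * (b0 - a0) \<le> H 3 b0 - H 3 a0" using ab0 by linarith
        moreover have "?P a b" if *: "?P (H 3 a0) (H 3 b0)"
        proof -
          obtain w x and n :: int where w: "set w \<subseteq> {1..k}" "H 3 a0 < x" "x < H 3 b0" "fold H w x + of_int n \<in> L"
            using * by blast
          obtain y where y: "H 3 y = x" using hlift_surj[OF hl, of 3] by auto
          have "a0 < y" "y < b0" using w y hlift_less_iff[OF hl, of 3] by auto
          moreover have "H 3 (y + of_int M) = x + of_int M" using hlift_translate[OF hl, of 3] y by simp
          moreover have "fold H w (x + of_int M) = fold H w x + of_int M"
            by (rule hlift_translate[OF hlift_fold[OF H w(1)]])
          ultimately show ?thesis using w k
            by (intro exI[of _ "3 # w"] exI[of _ "y + of_int M"] exI[of _ "n - M"]) (auto simp: a0_def b0_def)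
        qed
        ultimately show False using nope M by (auto simp: a0_def b0_def)
      qed
    qed
  qed
  have bl: "\<And>i x. i \<in> {1, 2} \<Longrightarrow> x \<in> {1/5..4/5} \<Longrightarrow> H i x \<in> {1/5..4/5}"
    "\<And>i x y. i \<in> {1, 2} \<Longrightarrow> x \<in> {1/5..4/5} \<Longrightarrow> y \<in> {1/5..4/5} \<Longrightarrow> \<bar>H i x - H i y\<bar> \<le> 3/4 * \<bar>x - y\<bar>"
    "\<And>y. y \<in> {7/20..13/20} \<Longrightarrow> \<exists>i\<in>{1, 2}. \<exists>z\<in>{7/20..13/20}. H i z = y"
    using affine_blender[of H 1 2 "1/1000" Psi "1/5" "4/5" "1/9" "2/9" "7/20" "13/20" "1/2"]
      hl[of 1] hl[of 2] ner[of 1] ner[of 2] Psi_values(1,2) by simp_all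
  show ?thesis unfolding trans_ifs_def
  proof (intro allI impI)
    fix a b c d :: real assume "a < b" "c < d"
    obtain w x and n :: int where w: "set w \<subseteq> {1..k}" "a < x" "x < b" "fold H w x + of_int n \<in> {1/5..4/5}"
      using forw[OF \<open>a < b\<close>] by (auto simp: L_def)
    obtain v and m :: int where v: "set v \<subseteq> {1..k}"
      "\<forall>x\<in>{1/5..4/5}. c < fold H v x + of_int m \<and> fold H v x + of_int m < d"
      using blender_reach[where J="{7/20..13/20}" and lam="3/4", OF H _ bl _ _ _ backw[OF \<open>c < d\<close>, unfolded J_def]] k
      by force
    have "fold H v (fold H w x + of_int n) = fold H v (fold H w x) + of_int n"
      by (rule hlift_translate[OF hlift_fold[OF H v(1)]])
    then show "\<exists>w x. \<exists>n::int. set w \<subseteq> {1..k} \<and> a < x \<and> x < b \<and>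
        c < fold H w x + of_int n \<and> fold H w x + of_int n < d"
      using bspec[OF v(2) w(4)] w v(1)
      by (intro exI[of _ "w @ v"] exI[of _ x] exI[of _ "n + m"]) (auto simp: add.assoc)
  qed
qed

section \<open>A robustly minimal family preserving a Cantor-like set backwards\<close>

text \<open>Letters 7 and 8 are \<open>P_map\<close> and its mirror image under x -> 4/9 - x, which
  exchanges C and C + 1/3. Letters 1 to 3 are x/4 around 2/9, up to a rotation by a third; the
  constant 1/18 is a quarter of 2/9. The other positive letters are rotations by thirds.\<close>

definition Phi :: "nat \<Rightarrow> real \<Rightarrow> real" where
  "Phi i = (if i = 7 then P_map else if i = 8 then (\<lambda>x. 4/9 - P_map (4/9 - x))
     else if i \<le> 3 then (\<lambda>x. T_map (x - 2/9) + 1/18 + i / 3) else (\<lambda>x. x + i / 3))"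

lemma IFS_Phi: "IFS r k Phi"
proof -
  have "circ_diff r (Phi i)" for i
    using circ_diff_mirror[OF P_map_lift_diffeo, of r "4/9" "4/9"] lift_diffeo_circ_diff[OF P_map_lift_diffeo, of r]
      circ_diff_rotate[OF T_map_lift_diffeo, of r "-2/9" "1/18 + i / 3"]
      lift_diffeo_circ_diff[OF lift_diffeo_translation, of r "i / 3"]
    by (auto simp: Phi_def add.assoc)
  then show ?thesis by (simp add: IFS_def)
qed

lemma Phi_values:
  "i \<in> {1,2,3} \<Longrightarrow> \<bar>x - 2/9\<bar> \<le> 399/1000 \<Longrightarrow> Phi i x = (x - 2/9) / 4 + 1/18 + i / 3"
  "i \<in> {4,5,6} \<Longrightarrow> Phi i x = x + i / 3"
  "x \<in> {7/60..59/180} \<Longrightarrow> Phi 7 x = 2/3 * x + 5/108"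
  "x \<in> {7/60..59/180} \<Longrightarrow> Phi 8 x = 2/3 * x + 11/108"
proof -
  show "x \<in> {7/60..59/180} \<Longrightarrow> Phi 8 x = 2/3 * x + 11/108"
    using P_map_values(3)[of "4/9 - x"] by (simp add: Phi_def field_simps)
qed (auto simp: Phi_def T_map_contract P_map_values)

lemma near_self: "0 \<le> \<epsilon> \<Longrightarrow> near \<epsilon> F F"
  by (simp add: near_def)

lemma residue_mod_3: "\<exists>j\<in>{0..<3::int}. \<exists>n. M = j + 3 * n"
  by (intro bexI[of _ "M mod 3"] exI[of _ "M div 3"]) auto

text \<open>Letter 7 or 8 brings any point into the blender arc at once, whence the uniformity in y
  and in the length. Backwards, rotated copies of J cover the gaps, while arcs near a set C + M/3
  are enlarged by inverses of letters 1 to 3. The result serves both robust transitivity and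
  minimality.\<close>

lemma Phi_reach:
  assumes k: "k \<ge> 8" and H: "hlifts k H" and nr: "\<And>i. i \<in> {1..k} \<Longrightarrow> near (1/1000) (Phi i) (H i)"
    and "c < d"
  shows "\<exists>N. \<forall>n\<ge>N. \<forall>y. \<exists>w. \<exists>m::int. length w = n \<and> set w \<subseteq> {1..k} \<and>
    c < fold H w y + of_int m \<and> fold H w y + of_int m < d"
proof -
  have hl: "hlift (H i)" if "i \<in> {1..8}" for i using H that k by (auto simp: hlifts_def)
  have ner: "near (1/1000) (Phi i) (H i)" if "i \<in> {1..8}" for i using nr that k by auto
  define J where "J = {13/90..3/10::real}"
  have backw: "\<exists>w z. \<exists>n::int. set w \<subseteq> {1..k} \<and> z \<in> J \<and> a < fold H w z + of_int n \<and> fold H w z + of_int n < b"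
    if "a < b" for a b
  proof (rule growth_induct[OF _ that])
    fix a b :: real assume "a < b"
    let ?P = "\<lambda>a b. \<exists>w z. \<exists>n::int. set w \<subseteq> {1..k} \<and> z \<in> J \<and>
        a < fold H w z + of_int n \<and> fold H w z + of_int n < b"
    show "?P a b \<or> (b - a \<le> 1 \<and> (\<exists>a' b'. 2 * (b - a) \<le> b' - a' \<and> (?P a' b' \<longrightarrow> ?P a b)))"
    proof (rule disjCI)
      assume nope: "\<not> (b - a \<le> 1 \<and> (\<exists>a' b'. 2 * (b - a) \<le> b' - a' \<and> (?P a' b' \<longrightarrow> ?P a b)))"
      show "?P a b"
      proof (rule ccontr)
        assume np: "\<not> ?P a b"
        \<comment> \<open>With margin 1/25, the shortened gaps fit into rotated copies of J, and the
          enlarged hulls of C + M/3 fit into the images of the x/4 branches, both with room for the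
          perturbation.\<close>
        have "False" if y: "a < y" "y < b" "(1/9 + 1/25) + of_int M * (1/3) \<le> y" "y \<le> (1/3 - 1/25) + of_int M * (1/3)"
          for y :: real and M
        proof -
          \<comment> \<open>The offset 4 picks the rotation among the letters 4, 5, 6 that is
            congruent to M modulo 3.\<close>
          obtain j :: int and n where j: "0 \<le> j" "j < 3" "M - 4 = j + 3 * n"
            using residue_mod_3[of "M - 4"] by auto
          define i where "i = nat (j + 4)"
          have i: "i \<in> {4,5,6}" "real i = of_int j + 4" using j by (auto simp: i_def)
          have "real_of_int M = of_int j + 4 + 3 * of_int n" using j(3) by linarith
          then have Mi: "real_of_int M * (1/3) = real i / 3 + of_int n" using i by simp
          have "\<exists>z\<in>{13/90..3/10}. H i z = y - of_int n"
          proof (rule near_IVT[OF hl ner])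
            show "Phi i (13/90) + 1/1000 \<le> y - of_int n" "y - of_int n \<le> Phi i (3/10) - 1/1000"
              using y(3,4) unfolding Mi Phi_values(2)[OF i(1)] by simp_all
          qed (use i in auto)
          then obtain z where "z \<in> J" "H i z = y - of_int n" by (auto simp: J_def)
          then have "?P a b" using y k i
            by (intro exI[of _ "[i]"] exI[of _ z] exI[of _ n]) auto
          with np show False by blast
        qed
        then obtain M :: int where M: "-1/25 + of_int M * (1/3) \<le> a" "b \<le> (1/9 + 1/25) + of_int M * (1/3)"
          using interval_in_gap[of "1/9 + 1/25" "1/3 - 1/25" "1/3" a b] \<open>a < b\<close> by auto
        \<comment> \<open>The offset 1 picks instead the contraction among the letters 1, 2, 3 with
          the right rotation.\<close>
        obtain j :: int and n where j: "0 \<le> j" "j < 3" "M - 1 = j + 3 * n" using residue_mod_3[of "M - 1"] by auto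
        define i where "i = nat (j + 1)"
        have i: "i \<in> {1,2,3}" "real i = of_int j + 1" using j by (auto simp: i_def)
        have "real_of_int M = of_int j + 1 + 3 * of_int n" using j(3) by linarith
        then have Mi: "real_of_int M * (1/3) = real i / 3 + of_int n" using i by simp
        obtain a' b' where ab: "2 * ((b - of_int n) - (a - of_int n)) \<le> b' - a'"
          "\<And>x. a' < x \<Longrightarrow> x < b' \<Longrightarrow> a - of_int n < H i x \<and> H i x < b - of_int n"
        proof (rule back_chart[of "H i" "1/1000" "Phi i" "2/9 - 399/1000" "2/9 + 399/1000" "1/4" "a - of_int n" "b - of_int n"])
          show "hlift (H i)" "near (1/1000) (Phi i) (H i)" using i hl ner by auto
          show "Phi i x - Phi i y = 1/4 * (x - y)"
            if "x \<in> {2/9 - 399/1000..2/9 + 399/1000}" "y \<in> {2/9 - 399/1000..2/9 + 399/1000}" for x y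
          proof -
            have "\<bar>x - 2/9\<bar> \<le> 399/1000" "\<bar>y - 2/9\<bar> \<le> 399/1000"
              using that unfolding atLeastAtMost_iff by linarith+
            then show ?thesis using Phi_values(1)[OF i(1), of x] Phi_values(1)[OF i(1), of y] by (simp add: field_simps)
          qed
          show "Phi i (2/9 - 399/1000) + 1/1000 \<le> a - of_int n" "b - of_int n \<le> Phi i (2/9 + 399/1000) - 1/1000"
            using Phi_values(1)[OF i(1), of "2/9 - 399/1000"] Phi_values(1)[OF i(1), of "2/9 + 399/1000"]
              M[unfolded Mi] by simp_all
        qed (use \<open>a < b\<close> in auto)
        have "?P a b" if *: "?P a' b'"
        proof -
          obtain w z and l :: int where w: "set w \<subseteq> {1..k}" "z \<in> J" "a' < fold H w z + of_int l" "fold H w z + of_int l < b'"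
            using * by blast
          have "H i (fold H w z + of_int l) = H i (fold H w z) + of_int l" using hlift_translate[OF hl, of i] i by auto
          then show ?thesis using ab(2)[OF w(3,4)] w k i
            by (intro exI[of _ "w @ [i]"] exI[of _ z] exI[of _ "l + n"]) auto
        qed
        with nope ab(1) M show False by auto
      qed
    qed
  qed
  have P_range: "P_map x \<in> {124/1000..32/100}" if "x \<in> {7/60..499/500}" for x
  proof -
    have "hlift P_map" using circ_diff_hlift[OF lift_diffeo_circ_diff[OF P_map_lift_diffeo]] .
    from hlift_le_iff[OF this, of "7/60" x] hlift_le_iff[OF this, of x "499/500"] that
    show ?thesis using P_map_values(3)[of "7/60"] P_map_values(4) by auto
  qed
  have forw: "\<exists>i\<in>{7,8}. \<exists>n::int. H i x + of_int n \<in> {7/60..59/180}" for x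
  proof -
    \<comment> \<open>The fundamental domain starts at -1/500 in order to avoid the steep part of
      \<open>P_map\<close> just below 1.\<close>
    define n where "n = \<lfloor>x + 1/500\<rfloor>"
    define y where "y = x - of_int n"
    have y: "-1/500 \<le> y" "y \<le> 499/500" unfolding y_def n_def by linarith+
    have tr: "H i x + of_int (- n) = H i y" if "i \<in> {7,8}" for i
      using hlift_translate[OF hl, of i y n] that by (auto simp: y_def)
    show ?thesis
    proof (cases "7/60 \<le> y")
      case True
      then have "Phi 7 y \<in> {124/1000..32/100}" using P_range[of y] y by (simp add: Phi_def)
      then have "H 7 y \<in> {7/60..59/180}" using near_bound[OF ner[of 7], of y] unfolding atLeastAtMost_iff by (simp; linarith)
      then show ?thesis using tr[of 7] by (intro bexI[of _ 7] exI[of _ "- n"]) auto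
    next
      case False
      \<comment> \<open>For y below 7/60 the mirror point 4/9 - y lies in the range where
        \<open>P_map\<close> lands in the gap.\<close>
      then have "4/9 - Phi 8 y \<in> {124/1000..32/100}" using P_range[of "4/9 - y"] y by (simp add: Phi_def)
      then have "H 8 y \<in> {7/60..59/180}" using near_bound[OF ner[of 8], of y] unfolding atLeastAtMost_iff by (simp; linarith)
      then show ?thesis using tr[of 8] by (intro bexI[of _ 8] exI[of _ "- n"]) auto
    qed
  qed
  have bl: "\<And>i x. i \<in> {7, 8} \<Longrightarrow> x \<in> {7/60..59/180} \<Longrightarrow> H i x \<in> {7/60..59/180}"
    "\<And>i x y. i \<in> {7, 8} \<Longrightarrow> x \<in> {7/60..59/180} \<Longrightarrow> y \<in> {7/60..59/180} \<Longrightarrow> \<bar>H i x - H i y\<bar> \<le> 3/4 * \<bar>x - y\<bar>"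
    "\<And>y. y \<in> J \<Longrightarrow> \<exists>i\<in>{7, 8}. \<exists>z\<in>J. H i z = y"
    unfolding J_def
    using affine_blender[of H 7 8 "1/1000" Phi "7/60" "59/180" "5/108" "11/108" "13/90" "3/10" "2/9"]
      hl[of 7] hl[of 8] ner[of 7] ner[of 8] Phi_values(3,4) by simp_all
  obtain N where N: "\<And>n. n \<ge> N \<Longrightarrow> \<exists>w. \<exists>m::int. length w = n \<and> set w \<subseteq> {1..k} \<and>
    (\<forall>x\<in>{7/60..59/180}. c < fold H w x + of_int m \<and> fold H w x + of_int m < d)"
    using blender_reach[where J=J and lam="3/4", OF H _ bl _ _ _ backw[OF \<open>c < d\<close>]] k
    by (force simp: J_def)
  show ?thesis
  \<comment> \<open>One extra letter is spent on entering the blender.\<close>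
  proof (intro exI[of _ "Suc N"] allI impI)
    fix n y assume "Suc N \<le> n"
    then have "N \<le> n - 1" by simp
    from N[OF this] obtain w and m :: int where w: "length w = n - 1" "set w \<subseteq> {1..k}"
      "\<forall>x\<in>{7/60..59/180}. c < fold H w x + of_int m \<and> fold H w x + of_int m < d"
      by blast
    obtain i and l :: int where i: "i \<in> {7,8}" "H i y + of_int l \<in> {7/60..59/180}" using forw by blast
    have "fold H w (H i y + of_int l) = fold H w (H i y) + of_int l"
      by (rule hlift_translate[OF hlift_fold[OF H w(2)]])
    then show "\<exists>w. \<exists>m::int. length w = n \<and> set w \<subseteq> {1..k} \<and>
      c < fold H w y + of_int m \<and> fold H w y + of_int m < d"
      using bspec[OF w(3) i(2)] w i(1) k \<open>Suc N \<le> n\<close>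
      by (intro exI[of _ "i # w"] exI[of _ "l + m"]) (auto simp: add.assoc)
  qed
qed

lemma Phi_robust:
  assumes "k \<ge> 8" "hlifts k H" "\<And>i. i \<in> {1..k} \<Longrightarrow> near (1/1000) (Phi i) (H i)"
  shows "trans_ifs k H"
  unfolding trans_ifs_def
proof (intro allI impI)
  fix a b c d :: real assume "a < b" "c < d"
  then show "\<exists>w x. \<exists>n::int. set w \<subseteq> {1..k} \<and> a < x \<and> x < b \<and>
      c < fold H w x + of_int n \<and> fold H w x + of_int n < d"
    using Phi_reach[OF assms \<open>c < d\<close>] dense[OF \<open>a < b\<close>] by (meson order_refl)
qed

section \<open>Minimality of the strong foliations\<close>

text \<open>The word length must be exactly \<open>n\<close>: a strong unstable leaf through \<open>(\<omega>, x)\<close> only sees points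
  \<open>f\<^sub>w (f\<^sub>\<omega>\<^sup>-\<^sup>n x)\<close> with \<open>w\<close> of length \<open>n\<close>.\<close>

lemma uu_minimalI:
  assumes G: "hlifts k G" and \<nu>: "0 < \<nu>" "\<nu> < 1"
    and reach: "\<And>c d. c < d \<Longrightarrow> \<exists>N. \<forall>n\<ge>N. \<forall>y. \<exists>w. \<exists>m::int. length w = n \<and> set w \<subseteq> {1..k} \<and>
      c < fold G w y + of_int m \<and> fold G w y + of_int m < d"
  shows "uu_minimal k \<nu> G"
  unfolding uu_minimal_def
proof
  fix p assume p: "p \<in> phase k"
  obtain \<omega> x where px: "p = (\<omega>, x)" by (cases p)
  have \<omega>: "\<omega> \<in> Sigma_k k" and x: "x \<in> circ" using p by (auto simp: px phase_def)
  show "dense_in_phase k \<nu> (Wuu k G p)"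
  proof (rule dense_in_phaseI[OF \<nu>])
    fix \<eta> m and c d :: real assume \<eta>: "\<eta> \<in> Sigma_k k" and "c < d"
    \<comment> \<open>The last m letters before time n have to spell the past of \<eta>, so the
      target arc is pulled back by u and w aims at the pulled-back arc.\<close>
    define u where "u = map (\<lambda>j. \<eta> (int j - int m)) [0..<m]"
    have u: "set u \<subseteq> {1..k}" using \<eta> by (auto simp: u_def Sigma_k_def)
    note hu = hlift_fold[OF G u]
    obtain c0 d0 where c0: "fold G u c0 = c" and d0: "fold G u d0 = d" using hlift_surj[OF hu] by metis
    then have "c0 < d0" using \<open>c < d\<close> hlift_less_iff[OF hu] by blast
    then obtain N where N: "\<And>n y. n \<ge> N \<Longrightarrow> \<exists>w. \<exists>l::int. length w = n \<and> set w \<subseteq> {1..k} \<and>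
      c0 < fold G w y + of_int l \<and> fold G w y + of_int l < d0" using reach by meson
    define n where "n = N + m"
    define past where "past = map (\<lambda>j. \<omega> (int j - int n)) [0..<n]"
    have past: "set past \<subseteq> {1..k}" using \<omega> by (auto simp: past_def Sigma_k_def)
    \<comment> \<open>Modulo 1, y0 is the n-th backward image of x along \<omega>.\<close>
    obtain y0 where y0: "fold G past y0 = x" using hlift_surj[OF hlift_fold[OF G past]] by blast
    define y where "y = frac y0"
    have yc: "y \<in> circ" by (simp add: y_def circ_def frac_lt_1)
    obtain w and l :: int where w: "length w = N" "set w \<subseteq> {1..k}"
      "c0 < fold G w y + of_int l" "fold G w y + of_int l < d0" using N[of N y] by auto
    \<comment> \<open>The past is that of \<omega> shifted back n steps, which puts \<theta> in its
      local unstable set; then follow w, the block u and the future of \<eta>.\<close>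
    define \<theta> where "\<theta> = (\<lambda>i::int. if i < 0 then \<omega> (i - int n)
      else if i < int N then w ! nat i else \<eta> (i - int n))"
    have "\<theta> i \<in> {1..k}" for i
      using \<omega> \<eta> nth_mem[of "nat i" w] w(1,2) by (force simp: \<theta>_def Sigma_k_def)
    then have \<theta>: "\<theta> \<in> Sigma_k k" by (simp add: Sigma_k_def)
    have \<theta>w: "map (\<lambda>j. \<theta> (int j)) [0..<n] = w @ u"
      by (rule nth_equalityI) (auto simp: \<theta>_def n_def w(1) u_def nth_append of_nat_diff diff_diff_eq)
    have "(\<lambda>i. \<omega> (i - int n)) \<in> Sigma_k k" using \<omega> by (simp add: Sigma_k_def)
    then have "snd ((skew G ^^ n) (\<lambda>i. fst p (i - int n), y)) = frac (fold G past y)"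
      using skew_iterate[OF G _ yc] by (simp add: px past_def)
    also have "\<dots> = x"
      using frac_hlift_frac[OF hlift_fold[OF G past], of y0] y0 x
      by (simp add: y_def circ_def frac_eq)
    finally have "(skew G ^^ n) (\<theta>, y) \<in> Wuu k G p"
      unfolding Wuu_def using \<theta> yc by (fastforce simp: px \<theta>_def)
    note mem = this
    have q: "(skew G ^^ n) (\<theta>, y) = (\<lambda>i. \<theta> (i + int n), frac (fold G u (fold G w y)))"
      using skew_iterate[OF G \<theta> yc, of n] by (simp add: \<theta>w)
    have "\<theta> (i + int n) = \<eta> i" if "\<bar>i\<bar> \<le> int m" for i
      using that by (auto simp: \<theta>_def n_def)
    moreover have "fold G u (fold G w y + of_int l) = fold G u (fold G w y) + of_int l"
      by (rule hlift_translate[OF hu])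
    then have "c < frac (fold G u (fold G w y)) + of_int (l + \<lfloor>fold G u (fold G w y)\<rfloor>)"
      "frac (fold G u (fold G w y)) + of_int (l + \<lfloor>fold G u (fold G w y)\<rfloor>) < d"
      using w(3,4) hlift_less_iff[OF hu, of c0 "fold G w y + of_int l"]
        hlift_less_iff[OF hu, of "fold G w y + of_int l" d0] c0 d0 by (simp_all add: frac_def)
    ultimately show "\<exists>q\<in>Wuu k G p. (\<forall>i. \<bar>i\<bar> \<le> int m \<longrightarrow> fst q i = \<eta> i) \<and>
        (\<exists>n::int. c < snd q + of_int n \<and> snd q + of_int n < d)"
      using mem unfolding q
      by (intro bexI[of _ "(\<lambda>i. \<theta> (i + int n), frac (fold G u (fold G w y)))"] conjI
          exI[of _ "l + \<lfloor>fold G u (fold G w y)\<rfloor>"]) auto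
  qed
qed

section \<open>Leaves that are not dense\<close>

lemma not_dense_in_phaseI:
  assumes "k \<ge> 1" "z \<in> circ" "0 < \<epsilon>" "\<And>q. q \<in> A \<Longrightarrow> cdist z (snd q) \<ge> \<epsilon>"
  shows "\<not> dense_in_phase k \<nu> A"
proof
  assume "dense_in_phase k \<nu> A"
  moreover have "((\<lambda>_. 1), z) \<in> phase k" using assms by (simp add: phase_def Sigma_k_def)
  ultimately obtain q where "q \<in> A" "cdist z (snd q) < \<epsilon>"
    using \<open>0 < \<epsilon>\<close> unfolding dense_in_phase_def by (metis snd_conv)
  with assms(4) show False by fastforce
qed

text \<open>A point of the stable leaf shares a forward image with (\<omega>, x), possibly along
  another word; pulling back letter by letter never leaves K.\<close>

lemma Wss_backward_invariant:
  assumes G: "hlifts k G" and \<omega>: "\<omega> \<in> Sigma_k k" and x: "x \<in> circ"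
    and K: "\<And>n y. y \<in> K \<Longrightarrow> y + of_int (n::int) \<in> K"
    and inv: "\<And>i y. i \<in> {1..k} \<Longrightarrow> G i y \<in> K \<Longrightarrow> y \<in> K"
    and orb: "\<And>n. fold G (map (\<lambda>j. \<omega> (int j)) [0..<n]) x \<in> K"
    and q: "q \<in> Wss k G (\<omega>, x)"
  shows "snd q \<in> K"
proof -
  obtain n where qp: "q \<in> phase k" "snd ((skew G ^^ n) q) = snd ((skew G ^^ n) (\<omega>, x))"
    using q by (auto simp: Wss_def)
  obtain \<theta> y where q': "q = (\<theta>, y)" by (cases q)
  have \<theta>: "\<theta> \<in> Sigma_k k" "y \<in> circ" using qp by (auto simp: q' phase_def)
  have "frac (fold G (map (\<lambda>j. \<theta> (int j)) [0..<n]) y) = frac (fold G (map (\<lambda>j. \<omega> (int j)) [0..<n]) x)"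
    using qp(2) skew_iterate[OF G \<theta>] skew_iterate[OF G \<omega> x] by (simp add: q')
  then have "fold G (map (\<lambda>j. \<theta> (int j)) [0..<n]) y \<in> K"
    using K orb by (metis frac_eqE)
  moreover have pull: "y \<in> K" if "set w \<subseteq> {1..k}" "fold G w y \<in> K" for w y
    using that
  proof (induction w arbitrary: y)
    case (Cons i w)
    then have "G i y \<in> K" by simp
    then show ?case using inv[of i y] Cons.prems(1) by simp
  qed simp
  moreover have "set (map (\<lambda>j. \<theta> (int j)) [0..<n]) \<subseteq> {1..k}" using \<theta> by (auto simp: Sigma_k_def)
  ultimately show ?thesis using pull unfolding q' snd_conv by blast
qed

lemma fold_fixed_point: "(\<And>i. G i z = z) \<Longrightarrow> fold G w z = z"
  by (induction w) auto

text \<open>Words fix every integer and are injective, so no other point can be sent to an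
  integer.\<close>

lemma frac_fold_eq_0_iff:
  assumes G: "hlifts k G" "\<And>i. G i 0 = (0::real)" and w: "set w \<subseteq> {1..k}"
  shows "frac (fold G w y) = 0 \<longleftrightarrow> y \<in> \<int>"
proof -
  note h = hlift_fold[OF G(1) w]
  have *: "fold G w (of_int n) = of_int n" for n
    using hlift_translate[OF h, of 0 n] fold_fixed_point[of G 0 w] G(2) by simp
  have "fold G w y \<in> \<int> \<longleftrightarrow> y \<in> \<int>"
    using * hlift_le_iff[OF h] by (metis Ints_cases Ints_of_int antisym order_refl)
  then show ?thesis by (simp add: frac_eq_0_iff)
qed

text \<open>Both leaves through the point 0 over a constant sequence stay over 0, while 1/2 has
  circle distance 1/2 from it.\<close>

lemma common_fixed_point_not_minimal:
  assumes G: "hlifts k G" "\<And>i. G i 0 = (0::real)" and k: "k \<ge> 1"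
  shows "\<not> uu_minimal k \<nu> G" "\<not> ss_minimal k \<nu> G"
proof -
  define p where "p = ((\<lambda>_::int. 1::nat), 0::real)"
  have \<omega>: "(\<lambda>_. 1) \<in> Sigma_k k" and x: "(0::real) \<in> circ" using k by (auto simp: Sigma_k_def circ_def)
  have p: "p \<in> phase k" using \<omega> x by (simp add: p_def phase_def)
  have far: "1/2 \<le> cdist (1/2) y" if "y \<in> \<int>" for y
    using that by (auto simp: cdist_def frac_def elim!: Ints_cases)
  have ss: "snd q \<in> \<int>" if "q \<in> Wss k G p" for q
    using Wss_backward_invariant[OF G(1) \<omega> x, of \<int> q] that frac_fold_eq_0_iff[OF G, of "[_]"]
      fold_fixed_point[of G 0] G(2) by (simp add: p_def frac_eq_0_iff)
  have uu: "snd q \<in> \<int>" if q: "q \<in> Wuu k G p" for q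
  proof -
    from q obtain n \<eta> y where *: "q = (skew G ^^ n) (\<eta>, y)" "\<eta> \<in> Sigma_k k" "y \<in> circ"
      "snd ((skew G ^^ n) (\<lambda>i. 1, y)) = 0" by (auto simp: Wuu_def p_def)
    have "set (map (\<lambda>j. 1) [0..<n]) \<subseteq> {1..k}" "set (map (\<lambda>j. \<eta> (int j)) [0..<n]) \<subseteq> {1..k}"
      using k *(2) by (auto simp: Sigma_k_def)
    from frac_fold_eq_0_iff[OF G this(1), of y] frac_fold_eq_0_iff[OF G this(2), of y]
    show ?thesis using * skew_iterate[OF G(1) \<omega> *(3), of n] skew_iterate[OF G(1) *(2,3), of n]
      by simp
  qed
  have "\<not> dense_in_phase k \<nu> (Wuu k G p)" "\<not> dense_in_phase k \<nu> (Wss k G p)"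
    using uu ss far k by (intro not_dense_in_phaseI[where z="1/2" and \<epsilon>="1/2"]; simp add: circ_def)+
  then show "\<not> uu_minimal k \<nu> G" "\<not> ss_minimal k \<nu> G"
    using p unfolding uu_minimal_def ss_minimal_def by blast+
qed

text \<open>A countable dense subset of the Cantor set with ratio 1/4 in [0, 1/9]; its integer and third translates
  are invariant under the inverses of all maps of \<open>Phi\<close>.\<close>

inductive_set cantor :: "real set" where
  "0 \<in> cantor"
| "1/9 \<in> cantor"
| "y \<in> cantor \<Longrightarrow> y / 4 \<in> cantor"
| "y \<in> cantor \<Longrightarrow> (y + 1/3) / 4 \<in> cantor"

definition cantor3 :: "real set" where
  "cantor3 = {y + of_int M / 3 | y M. y \<in> cantor}"

lemma cantor_bounds: "y \<in> cantor \<Longrightarrow> 0 \<le> y \<and> y \<le> 1/9"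
  by (induction rule: cantor.induct) auto

lemma cantor_mirror: "y \<in> cantor \<Longrightarrow> 1/9 - y \<in> cantor"
proof (induction rule: cantor.induct)
  case (3 y)
  have "1/9 - y / 4 = ((1/9 - y) + 1/3) / 4" by simp
  then show ?case using cantor.intros(4)[OF 3(2)] by (simp only:)
next
  case (4 y)
  have "1/9 - (y + 1/3) / 4 = (1/9 - y) / 4" by (simp add: field_simps)
  then show ?case using cantor.intros(3)[OF 4(2)] by (simp only:)
qed (auto intro: cantor.intros)

text \<open>The seeds 0 and 1/9 are the fixed points of the two contractions, so the generated set
  satisfies the self-similarity exactly.\<close>

lemma cantor_cases4:
  assumes "y \<in> cantor" shows "4 * y \<in> cantor \<or> 4 * y - 1/3 \<in> cantor"
  using assms
proof cases
  case 2
  then have "4 * y - 1/3 = 1/9" by simp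
  then show ?thesis using cantor.intros(2) by metis
next
  case (3 z)
  then have "4 * y = z" by simp
  with 3 show ?thesis by metis
next
  case (4 z)
  then have "4 * y - 1/3 = z" by simp
  with 4 show ?thesis by metis
qed (auto intro: cantor.intros)

lemma cantor3_third: "y \<in> cantor3 \<Longrightarrow> y + of_int M / 3 \<in> cantor3"
proof -
  assume "y \<in> cantor3"
  then obtain z N where "z \<in> cantor" "y = z + of_int N / 3" by (auto simp: cantor3_def)
  then show ?thesis unfolding cantor3_def
    by (intro CollectI exI[of _ z] exI[of _ "N + M"]) (simp add: add_divide_distrib)
qed

lemma cantor3_int: "y \<in> cantor3 \<Longrightarrow> y + of_int n \<in> cantor3"
  using cantor3_third[of y "3 * n"] by simp

lemma cantor3_I: "y \<in> cantor \<Longrightarrow> y \<in> cantor3" "y - 1/3 \<in> cantor \<Longrightarrow> y \<in> cantor3" "y - 2/3 \<in> cantor \<Longrightarrow> y \<in> cantor3"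
  unfolding cantor3_def
  by (intro CollectI exI[of _ y] exI[of _ "0::int"], simp)
    (intro CollectI exI[of _ "y - 1/3"] exI[of _ "1::int"], simp,
      intro CollectI exI[of _ "y - 2/3"] exI[of _ "2::int"], simp)

lemma cantor3_cases:
  assumes "y \<in> cantor3"
  obtains n :: int where "y - of_int n \<in> cantor" | n :: int where "y - of_int n - 1/3 \<in> cantor"
    | n :: int where "y - of_int n - 2/3 \<in> cantor"
proof -
  obtain z M where z: "z \<in> cantor" "y = z + of_int M / 3" using assms by (auto simp: cantor3_def)
  obtain j :: int and n where j: "0 \<le> j" "j < 3" "M = j + 3 * n" using residue_mod_3[of M] by auto
  have "y - of_int n - of_int j / 3 = z" using z j by (simp add: add_divide_distrib)
  moreover have "j = 0 \<or> j = 1 \<or> j = 2" using j by linarith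
  ultimately show ?thesis using that z(1) by auto
qed

lemma hlift_inj_int:
  assumes "hlift F" "F x = F z + of_int n" shows "x = z + of_int n"
  using assms hlift_translate[OF assms(1), of z n] hlift_le_iff[OF assms(1)] by (metis antisym order_refl)

text \<open>F is injective modulo 1, so exhibiting one preimage in \<open>cantor3\<close> for each
  point identifies the only one.\<close>

lemma preimage_in_cantor3:
  assumes F: "hlift F" and sect: "\<And>y. y \<in> cantor \<Longrightarrow> \<exists>x\<in>cantor3. \<exists>n::int. F x = y + of_int n"
    "\<And>y. y \<in> cantor \<Longrightarrow> \<exists>x\<in>cantor3. \<exists>n::int. F x = y + 1/3 + of_int n"
    "\<And>y. y \<in> cantor \<Longrightarrow> \<exists>x\<in>cantor3. \<exists>n::int. F x = y + 2/3 + of_int n"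
    and x: "F x \<in> cantor3"
  shows "x \<in> cantor3"
proof -
  have *: "x \<in> cantor3" if "z \<in> cantor3" "F z = F x - of_int m + of_int n" for z and m n :: int
    using hlift_inj_int[OF F, of x z "m - n"] that(2) cantor3_int[OF that(1), of "m - n"] by simp
  from x show ?thesis
  proof (cases rule: cantor3_cases)
    case (1 m)
    then show ?thesis using sect(1)[OF 1] * by blast
  next
    case (2 m)
    then show ?thesis using sect(2)[OF 2] * by fastforce
  next
    case (3 m)
    then show ?thesis using sect(3)[OF 3] * by fastforce
  qed
qed

text \<open>On the contracting branch the map is x/4 and takes C and C + 1/3 together onto C; on the
  expanding branch it is 4x - 7/3 and takes C + 2/3 onto C + 1/3 and C + 2/3.\<close>

lemma E_preimage:
  assumes "T_map (x - 2/9) + 1/18 \<in> cantor3" shows "x \<in> cantor3"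
proof (rule preimage_in_cantor3[of "\<lambda>x. T_map (x - 2/9) + 1/18", OF _ _ _ _ assms])
  show "hlift (\<lambda>x. T_map (x - 2/9) + 1/18)"
    using circ_diff_hlift[OF circ_diff_rotate[OF T_map_lift_diffeo, of 0 "-2/9" "1/18"]] by simp
  fix y assume y: "y \<in> cantor"
  note b = cantor_bounds[OF y]
  have "4 * y \<in> cantor3" using cantor_cases4[OF y] cantor3_I by auto
  moreover have "T_map (4 * y - 2/9) + 1/18 = y"
  proof -
    have "\<bar>4 * y - 2/9\<bar> \<le> 399/1000" using b by linarith
    then show ?thesis by (simp add: T_map_contract field_simps)
  qed
  ultimately show "\<exists>x\<in>cantor3. \<exists>n::int. T_map (x - 2/9) + 1/18 = y + of_int n"
    by (intro bexI[of _ "4 * y"] exI[of _ 0]) auto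
  have "y / 4 + 2/3 \<in> cantor3" using cantor3_I(3)[of "y / 4 + 2/3"] cantor.intros(3)[OF y] by simp
  moreover have "T_map (y / 4 + 2/3 - 2/9) + 1/18 = y + 1/3"
    using b T_map_expand[of "y / 4 + 2/3 - 2/9"] by (simp add: field_simps)
  ultimately show "\<exists>x\<in>cantor3. \<exists>n::int. T_map (x - 2/9) + 1/18 = y + 1/3 + of_int n"
    by (intro bexI[of _ "y / 4 + 2/3"] exI[of _ 0]) auto
  have "(y + 1/3) / 4 + 2/3 \<in> cantor3" using cantor3_I(3)[of "(y + 1/3) / 4 + 2/3"] cantor.intros(4)[OF y] by simp
  moreover have "T_map ((y + 1/3) / 4 + 2/3 - 2/9) + 1/18 = y + 2/3"
    using b T_map_expand[of "(y + 1/3) / 4 + 2/3 - 2/9"] by (simp add: field_simps)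
  ultimately show "\<exists>x\<in>cantor3. \<exists>n::int. T_map (x - 2/9) + 1/18 = y + 2/3 + of_int n"
    by (intro bexI[of _ "(y + 1/3) / 4 + 2/3"] exI[of _ 0]) auto
qed

text \<open>All preimages are found in C: the quarter (C + 1/3)/4 goes onto C, and the parts C/16
  and (C + 1/3)/16 go onto C + 1/3 and C + 2/3 up to an integer.\<close>

lemma P_preimage:
  assumes "P_map x \<in> cantor3" shows "x \<in> cantor3"
proof (rule preimage_in_cantor3[of P_map, OF _ _ _ _ assms])
  show "hlift P_map" using circ_diff_hlift[OF lift_diffeo_circ_diff[OF P_map_lift_diffeo]] .
  fix y assume y: "y \<in> cantor"
  note b = cantor_bounds[OF y]
  have "P_map ((y + 1/3) / 4) = y + of_int 0" using b P_map_values(2)[of "(y + 1/3) / 4"] by (simp add: field_simps)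
  then show "\<exists>x\<in>cantor3. \<exists>n::int. P_map x = y + of_int n"
    using cantor3_I(1)[OF cantor.intros(4)[OF y]] by blast
  have "P_map (y / 4 / 4) = y + 1/3 + of_int (- 1)" using b P_map_values(1)[of "y / 4 / 4"] by (simp add: field_simps)
  then show "\<exists>x\<in>cantor3. \<exists>n::int. P_map x = y + 1/3 + of_int n"
    using cantor3_I(1)[OF cantor.intros(3)[OF cantor.intros(3)[OF y]]] by blast
  have "P_map ((y + 1/3) / 4 / 4) = y + 2/3 + of_int (- 1)" using b P_map_values(1)[of "(y + 1/3) / 4 / 4"] by (simp add: field_simps)
  then show "\<exists>x\<in>cantor3. \<exists>n::int. P_map x = y + 2/3 + of_int n"
    using cantor3_I(1)[OF cantor.intros(3)[OF cantor.intros(4)[OF y]]] by blast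
qed

text \<open>C is symmetric about 1/18, and 4/9 = 1/9 + 1/3.\<close>

lemma cantor3_mirror: "y \<in> cantor3 \<Longrightarrow> 4/9 - y \<in> cantor3"
proof -
  assume "y \<in> cantor3"
  then obtain z M where "z \<in> cantor" "y = z + of_int M / 3" by (auto simp: cantor3_def)
  then show ?thesis unfolding cantor3_def using cantor_mirror
    by (intro CollectI exI[of _ "1/9 - z"] exI[of _ "1 - M"]) (auto simp: field_simps)
qed

lemma Phi_preimage:
  assumes "Phi i x \<in> cantor3" shows "x \<in> cantor3"
proof -
  have shift: "y \<in> cantor3" if "y + real i / 3 \<in> cantor3" for y
    using cantor3_third[OF that, of "- int i"] by simp
  consider "i = 7" | "i = 8" | "i \<le> 3" | "i \<noteq> 7" "i \<noteq> 8" "\<not> i \<le> 3" by blast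
  then show ?thesis
  proof cases
    case 1
    then show ?thesis using assms P_preimage by (simp add: Phi_def)
  next
    case 2
    then have "P_map (4/9 - x) \<in> cantor3" using cantor3_mirror[OF assms] by (simp add: Phi_def)
    from cantor3_mirror[OF P_preimage[OF this]] show ?thesis by simp
  next
    case 3
    then have "T_map (x - 2/9) + 1/18 + real i / 3 \<in> cantor3" using assms by (simp add: Phi_def)
    then show ?thesis using E_preimage shift by blast
  next
    case 4
    then have "x + real i / 3 \<in> cantor3" using assms by (simp add: Phi_def)
    then show ?thesis using shift by blast
  qed
qed

text \<open>2/9 is the midpoint of the gap between C and C + 1/3, whose ends are 1/9 and
  1/3.\<close>

lemma cantor3_avoids: "y \<in> cantor3 \<Longrightarrow> 1/9 \<le> cdist (2/9) y"
proof (rule ccontr)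
  assume "y \<in> cantor3" "\<not> 1/9 \<le> cdist (2/9) y"
  then obtain z M and n :: int where z: "z \<in> cantor" "y = z + of_int M / 3"
    and "\<bar>2/9 - y - of_int n\<bar> < 1/9"
    unfolding cantor3_def not_le cdist_less_iff by blast
  then have "real_of_int M + 3 * of_int n < 1" "0 < real_of_int M + 3 * of_int n"
    using cantor_bounds[OF z(1)] z(2) by linarith+
  then have "M + 3 * n < 1" "0 < M + 3 * n" by linarith+
  then show False by linarith
qed

lemma Phi_not_ss_minimal:
  assumes k: "k \<ge> 8" and G: "hlifts k Phi"
  shows "\<not> ss_minimal k \<nu> Phi"
proof -
  \<comment> \<open>Letter 6 is translation by 2, the identity of the circle, so the orbit of 0
    stays over a point of C.\<close>
  have \<omega>: "(\<lambda>_. 6) \<in> Sigma_k k" and x: "(0::real) \<in> circ" using k by (auto simp: Sigma_k_def circ_def)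
  have orb: "fold Phi (map (\<lambda>j. 6) [0..<n]) 0 \<in> cantor3" for n
  proof -
    have "fold Phi (map (\<lambda>j. 6) [0..<n]) 0 = of_int (2 * int n)"
      by (induction n) (auto simp: Phi_values(2))
    then show ?thesis using cantor3_int[OF cantor3_I(1)[OF cantor.intros(1)], of "2 * int n"] by simp
  qed
  have "snd q \<in> cantor3" if "q \<in> Wss k Phi (\<lambda>_. 6, 0)" for q
    by (rule Wss_backward_invariant[OF G \<omega> x cantor3_int Phi_preimage orb that])
  then have "\<not> dense_in_phase k \<nu> (Wss k Phi (\<lambda>_. 6, 0))"
    using cantor3_avoids k by (intro not_dense_in_phaseI[where z="2/9" and \<epsilon>="1/9"]) (auto simp: circ_def)
  moreover have "((\<lambda>_. 6), 0) \<in> phase k" using \<omega> x by (simp add: phase_def)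
  ultimately show ?thesis unfolding ss_minimal_def by blast
qed

theorem theoremC:
  fixes k :: nat and r :: enat and \<nu> :: real
  assumes "k \<ge> 8" and "1 \<le> r" and "0 < \<nu>" and "\<nu> < 1"
  shows "\<exists>\<Phi> \<Psi>. SRT r (k + 1) \<nu> \<Phi> \<and> SRT r k \<nu> \<Psi> \<and>
           uu_minimal (k + 1) \<nu> \<Phi> \<and> \<not> ss_minimal (k + 1) \<nu> \<Phi> \<and>
           \<not> uu_minimal k \<nu> \<Psi> \<and> \<not> ss_minimal k \<nu> \<Psi>"
proof (rule exI[of _ Phi], rule exI[of _ Psi], intro conjI)
  have hPhi: "hlifts (k + 1) Phi" and hPsi: "hlifts k Psi"
    using IFS_Phi[of 0 "k + 1"] IFS_Psi[of 0 k] circ_diff_hlift unfolding hlifts_def IFS_def by blast+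
  show "SRT r (k + 1) \<nu> Phi"
    by (rule SRT_I[where \<epsilon>="1/1000", OF assms(3,4) _ assms(2) IFS_Phi _ Phi_robust]) (use assms in auto)
  show "SRT r k \<nu> Psi"
    by (rule SRT_I[where \<epsilon>="1/1000", OF assms(3,4) _ assms(2) IFS_Psi _ Psi_robust]) (use assms in auto)
  show "uu_minimal (k + 1) \<nu> Phi"
  proof (rule uu_minimalI[OF hPhi assms(3,4)])
    \<comment> \<open>The family is \<open>near\<close> itself, so the robust reachability applies
      to it directly.\<close>
    fix c d :: real assume "c < d"
    then show "\<exists>N. \<forall>n\<ge>N. \<forall>y. \<exists>w. \<exists>m::int. length w = n \<and> set w \<subseteq> {1..k + 1} \<and>
        c < fold Phi w y + of_int m \<and> fold Phi w y + of_int m < d"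
      using assms(1) by (intro Phi_reach hPhi near_self) auto
  qed
  show "\<not> ss_minimal (k + 1) \<nu> Phi"
    using Phi_not_ss_minimal[OF _ hPhi] assms by simp
  show "\<not> uu_minimal k \<nu> Psi" "\<not> ss_minimal k \<nu> Psi"
    using common_fixed_point_not_minimal[OF hPsi Psi_0] assms by auto
qed

end
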